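(* Let $k\in\mathbb{N}$ and let $f_1,\dots,f_k:\mathbb{R}\to\mathbb{R}$ be (real) analytic functions. Then the following are equivalent: (1) The set $\{1,f_1,\dots,f_k\}$ is linearly independent over $\mathbb{R}$. (2) For every choice of scattered sequences $a_1,\dots,a_k:\mathbb{N}\to\mathbb{R}$, there exists a set of full Lebesgue measure of $x\in\mathbb{R}$ for which the sequence $\big(a_1(n)f_1(x),\dots,a_k(n)f_k(x)\big)_{n\in\mathbb{N}}$ is uniformly distributed in $\mathbb{T}^k$.
   Context: $\mathbb{N}=\{1,2,\dots\}$, $\mathbb{T}^k=\mathbb{R}^k/\mathbb{Z}^k$. A sequence $(x_n)_{n\in\mathbb{N}}$ in $\mathbb{R}^k$ is uniformly distributed in $\mathbb{T}^k$ (equivalently, uniformly distributed modulo 1) if for all intervals $I_1,\dots,I_k\subset[0,1]$, $\lim_{N\to\infty}\frac1N|\{n\in\{1,\dots,N\}:\{x_n\}\in I_1\times\cdots\times I_k\}|=\mu(I_1\times\cdots\times I_k)$, where $\mu$ is $k$-dimensional Lebesgue measure and $\{y\}$ is the vector of coordinatewise fractional parts of $y\in\mathbb{R}^k$. For $\delta\in(0,1]$, a sequence $a:\mathbb{N}\to\mathbb{R}$ is $\delta$-scattered if there exists $\epsilon>0$ such that for every sufficiently large $N$, $\frac1{N^2}\sum_{1\le m<n\le N}\min\big(|a(n)-a(m)|^{-\delta},1\big)\le\frac1{(\log N)^{1+\epsilon}}$ (with the term equal to $1$ when $a(n)=a(m)$). The sequence $a$ is scattered if it is $\delta$-scattered for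 every $\delta\in(0,1]$. Linear independence of $\{1,f_1,\dots,f_k\}$ is meant for the family (no nontrivial real linear combination of $1,f_1,\dots,f_k$ vanishes identically). *)

theory Defs
  imports "HOL-Analysis.Analysis"
begin

(* The library's analytic_on is about differentiability over the ground field, which for real
   functions is weaker than having local power series expansions. *)
definition real_analytic :: "(real \<Rightarrow> real) \<Rightarrow> bool" where
  "real_analytic f \<longleftrightarrow> (\<forall>x. \<exists>F. (\<lambda>h. f (x + h)) has_fps_expansion F)"

(* Sequences are indexed by the positive integers: the value at 0 is never used. *)

definition uniformly_distributed_mod1 :: "(nat \<Rightarrow> real ^ 'k) \<Rightarrow> bool" where
  "uniformly_distributed_mod1 x \<longleftrightarrow>
     (\<forall>I :: 'k \<Rightarrow> real set. (\<forall>i. is_interval (I i) \<and> I i \<subseteq> {0..1}) \<longrightarrow>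
        (\<lambda>N. real (card {n \<in> {1..N}. \<forall>i. frac (x n $ i) \<in> I i}) / real N)
          \<longlonglongrightarrow> measure lebesgue {y :: real ^ 'k. \<forall>i. y $ i \<in> I i})"

(* The case distinction is needed because 0 powr (- \<delta>) = 0, whereas the summand is 1
   when a n = a m. *)
definition delta_scattered :: "real \<Rightarrow> (nat \<Rightarrow> real) \<Rightarrow> bool" where
  "delta_scattered \<delta> a \<longleftrightarrow>
     (\<exists>\<epsilon>>0. eventually (\<lambda>N :: nat.
        1 / (real N)\<^sup>2 *
          (\<Sum>n\<in>{1..N}. \<Sum>m\<in>{1..<n}.
             if a n = a m then 1 else min (\<bar>a n - a m\<bar> powr (- \<delta>)) 1)
        \<le> 1 / (ln (real N)) powr (1 + \<epsilon>)) sequentially)"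

definition scattered :: "(nat \<Rightarrow> real) \<Rightarrow> bool" where
  "scattered a \<longleftrightarrow> (\<forall>\<delta>. 0 < \<delta> \<and> \<delta> \<le> 1 \<longrightarrow> delta_scattered \<delta> a)"

(* Independence of the family 1, f i (i :: 'k), not of the underlying set: repeated members
   make it dependent. *)
definition lin_indep_with_one :: "('k::finite \<Rightarrow> real \<Rightarrow> real) \<Rightarrow> bool" where
  "lin_indep_with_one f \<longleftrightarrow>
     (\<forall>c\<^sub>0 :: real. \<forall>c :: 'k \<Rightarrow> real.
        (\<forall>x. c\<^sub>0 * 1 + (\<Sum>i\<in>UNIV. c i * f i x) = 0) \<longrightarrow> c\<^sub>0 = 0 \<and> (\<forall>i. c i = 0))"

end

theory Submission
  imports Defs "HOL-Real_Asymp.Real_Asymp"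
begin

text \<open>
  Suppose the functions are independent. By Weyl's criterion it is enough that, for every nonzero
  integer vector \<open>h\<close>, the exponential averages of the phases \<open>\<Sum>i. h i * a i n * f i x\<close> tend to \<open>0\<close> for
  almost every \<open>x\<close>. Near any point, each nonzero combination \<open>\<Sum>i. c i * f i\<close> has a nonvanishing
  derivative of some order at least 1, since it is analytic and not constant; compactness of the unit
  sphere makes the order and the lower bound uniform. The van der Corput lemma then gives
  \<open>\<integral> cis (\<Sum>i. c i * f i) = O(norm c powr - \<delta>)\<close> on a small interval, so by \<open>\<delta>\<close>-scatteredness the mean
  square of the \<open>N\<close>-th average is \<open>O(1 / (ln N) powr (1 + \<epsilon>))\<close>. This is summable along
  \<open>N = \<lceil>exp (j powr \<alpha>)\<rceil>\<close> for suitable \<open>\<alpha> < 1\<close>, whose consecutive terms have ratio tending to \<open>1\<close>,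
  so convergence along it implies convergence.

  Conversely, a relation \<open>c\<^sub>0 + (\<Sum>i. c i * f i) = 0\<close> lets one choose \<open>a i n\<close> proportional to
  \<open>c i * 2 ^ n\<close> wherever \<open>c i \<noteq> 0\<close>, so that the sum of \<open>a i n * f i x\<close> over these \<open>i\<close> is always an
  integer; then no term of the sequence has all its fractional parts small and positive.
\<close>

section \<open>Real analytic functions\<close>

lemma real_analytic_has_deriv:
  assumes "real_analytic f"
  shows "(f has_real_derivative deriv f x) (at x)"
proof -
  from assms obtain F where F: "(\<lambda>h. f (x + h)) has_fps_expansion F"
    unfolding real_analytic_def by blast
  have "(eval_fps F has_field_derivative eval_fps (fps_deriv F) 0) (at 0)"
    using F by (intro has_field_derivative_eval_fps) (auto simp: has_fps_expansion_def zero_ereal_def)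
  moreover have "eventually (\<lambda>z. eval_fps F z = f (x + z)) (nhds 0)"
    using F by (simp add: has_fps_expansion_def)
  ultimately have "((\<lambda>h. f (x + h)) has_field_derivative eval_fps (fps_deriv F) 0) (at 0)"
    using DERIV_cong_ev[OF refl, of "eval_fps F" "\<lambda>h. f (x + h)" 0 "eval_fps (fps_deriv F) 0"] by simp
  hence "(f has_field_derivative eval_fps (fps_deriv F) 0) (at x)"
    using DERIV_shift[of f _ 0 x] by (simp add: add.commute)
  thus ?thesis by (simp add: DERIV_imp_deriv)
qed

text \<open>Holds without differentiability: \<open>deriv\<close> is defined by description, and the
  two derivative predicates described here coincide.\<close>

lemma deriv_shift_real:
  fixes f :: "real \<Rightarrow> real"
  shows "deriv (\<lambda>h. f (x + h)) h = deriv f (x + h)"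
  unfolding deriv_def using DERIV_shift[of f _ h x] by (simp add: add.commute)

lemma real_analytic_deriv:
  assumes "real_analytic f"
  shows "real_analytic (deriv f)"
  unfolding real_analytic_def
proof
  fix x
  from assms obtain F where "(\<lambda>h. f (x + h)) has_fps_expansion F"
    unfolding real_analytic_def by blast
  hence "deriv (\<lambda>h. f (x + h)) has_fps_expansion fps_deriv F"
    by (rule has_fps_expansion_deriv)
  moreover have "deriv (\<lambda>h. f (x + h)) = (\<lambda>h. deriv f (x + h))"
    using deriv_shift_real by auto
  ultimately show "\<exists>F. (\<lambda>h. deriv f (x + h)) has_fps_expansion F" by auto
qed

lemma real_analytic_higher_deriv:
  "real_analytic f \<Longrightarrow> real_analytic ((deriv ^^ n) f)"
  by (induction n) (auto intro: real_analytic_deriv)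

lemma real_analytic_higher_has_deriv:
  "real_analytic f \<Longrightarrow> ((deriv ^^ n) f has_real_derivative (deriv ^^ Suc n) f x) (at x)"
  using real_analytic_has_deriv[OF real_analytic_higher_deriv[of f n]] by simp

lemma real_analytic_linear_combination:
  fixes f :: "'k::finite \<Rightarrow> real \<Rightarrow> real"
  assumes "\<And>i. real_analytic (f i)"
  shows "real_analytic (\<lambda>x. \<Sum>i\<in>UNIV. c i * f i x)"
  unfolding real_analytic_def
proof
  fix x
  have "\<forall>i. \<exists>F. (\<lambda>h. f i (x + h)) has_fps_expansion F"
    using assms by (simp add: real_analytic_def)
  from choice[OF this] obtain F where "\<And>i. (\<lambda>h. f i (x + h)) has_fps_expansion F i" by auto
  hence "(\<lambda>h. \<Sum>i\<in>UNIV. c i * f i (x + h)) has_fps_expansion (\<Sum>i\<in>UNIV. fps_const (c i) * F i)"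
    by (intro has_fps_expansion_sum has_fps_expansion_cmult_left)
  thus "\<exists>F. (\<lambda>h. \<Sum>i\<in>UNIV. c i * f i (x + h)) has_fps_expansion F" by blast
qed

lemma higher_deriv_linear_combination:
  fixes f :: "'k::finite \<Rightarrow> real \<Rightarrow> real"
  assumes "\<And>i. real_analytic (f i)"
  shows "(deriv ^^ n) (\<lambda>x. \<Sum>i\<in>UNIV. c i * f i x) = (\<lambda>x. \<Sum>i\<in>UNIV. c i * (deriv ^^ n) (f i) x)"
proof (induction n)
  case (Suc n)
  have "((\<lambda>x. \<Sum>i\<in>UNIV. c i * (deriv ^^ n) (f i) x) has_real_derivative
          (\<Sum>i\<in>UNIV. c i * (deriv ^^ Suc n) (f i) x)) (at x)" for x
    by (intro DERIV_sum DERIV_cmult real_analytic_higher_has_deriv assms)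
  hence "deriv (\<lambda>x. \<Sum>i\<in>UNIV. c i * (deriv ^^ n) (f i) x) x = (\<Sum>i\<in>UNIV. c i * (deriv ^^ Suc n) (f i) x)" for x
    by (rule DERIV_imp_deriv)
  thus ?case using Suc by auto
qed simp

section \<open>Taylor coefficients and the identity theorem\<close>

text \<open>Passing to \<open>deriv f\<close> shifts the coefficients by one, so the induction has
  to vary both \<open>f\<close> and \<open>F\<close>.\<close>

lemma has_fps_expansion_nth_real:
  fixes f :: "real \<Rightarrow> real"
  assumes "f has_fps_expansion F"
  shows "fps_nth F n = (deriv ^^ n) f 0 / fact n"
  using assms
proof (induction n arbitrary: f F)
  case 0
  thus ?case
    using eventually_nhds_x_imp_x[of "\<lambda>z. eval_fps F z = f z" 0]
    by (simp add: has_fps_expansion_def eval_fps_at_0)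
next
  case (Suc n)
  have "fps_nth (fps_deriv F) n = (deriv ^^ n) (deriv f) 0 / fact n"
    by (rule Suc.IH[OF has_fps_expansion_deriv[OF Suc.prems]])
  thus ?case
    by (simp add: funpow_Suc_right field_simps del: funpow.simps of_nat_Suc)
qed

text \<open>The derivatives at \<open>x\<close> determine the local expansion, which is therefore
  the zero series.\<close>

lemma real_analytic_locally_zero:
  assumes f: "real_analytic f" and zero: "\<And>n. (deriv ^^ n) f x = 0"
  shows "eventually (\<lambda>y. f y = 0) (nhds x)"
proof -
  from f obtain F where F: "(\<lambda>h. f (x + h)) has_fps_expansion F"
    unfolding real_analytic_def by blast
  have shift: "(deriv ^^ n) (\<lambda>h. f (x + h)) = (\<lambda>h. (deriv ^^ n) f (x + h))" for n
    by (induction n) (auto simp: deriv_shift_real)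
  have "fps_nth F n = 0" for n
    using has_fps_expansion_nth_real[OF F, of n] zero shift by simp
  hence "F = 0" by (simp add: fps_eq_iff)
  hence "eventually (\<lambda>z. f (x + z) = 0) (nhds 0)"
    using F by (auto simp: has_fps_expansion_def elim: eventually_mono)
  hence "eventually (\<lambda>y. f y = 0) (filtermap (\<lambda>z. z - (-x)) (nhds 0))"
    by (simp add: eventually_filtermap add.commute)
  thus ?thesis by (simp only: filtermap_nhds_shift) simp
qed

text \<open>The set where all derivatives of \<open>deriv f\<close> vanish is closed by continuity
  and open by the local expansion. It contains \<open>x0\<close>, so by connectedness it is the
  whole line. Orders start at 1 because a nonzero constant is allowed.\<close>

lemma real_analytic_const_if_derivs_zero:
  assumes f: "real_analytic f" and zero: "\<And>n. n \<ge> 1 \<Longrightarrow> (deriv ^^ n) f x0 = 0"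
  shows "f x = f x0"
proof -
  define Z where "Z = {y. \<forall>n. (deriv ^^ n) (deriv f) y = 0}"
  have df: "real_analytic (deriv f)" by (rule real_analytic_deriv[OF f])
  have "open Z"
  proof (subst open_subopen, intro ballI)
    fix y assume "y \<in> Z"
    hence "eventually (\<lambda>u. deriv f u = 0) (nhds y)"
      by (intro real_analytic_locally_zero df) (auto simp: Z_def)
    then obtain S where S: "open S" "y \<in> S" "\<And>u. u \<in> S \<Longrightarrow> deriv f u = 0"
      unfolding eventually_nhds by blast
    have "u \<in> Z" if "u \<in> S" for u
    proof -
      have "(deriv ^^ n) (deriv f) u = (deriv ^^ n) (\<lambda>_. 0) u" for n
        using S that by (intro higher_deriv_cong_ev) (auto simp: eventually_nhds)
      moreover have "(deriv ^^ n) (\<lambda>_. 0::real) = (\<lambda>_. 0)" for n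
        by (induction n) auto
      ultimately show ?thesis by (simp add: Z_def)
    qed
    thus "\<exists>T. open T \<and> y \<in> T \<and> T \<subseteq> Z" using S by blast
  qed
  moreover have "closed Z"
  proof -
    have "continuous_on UNIV ((deriv ^^ n) (deriv f))" for n
      using real_analytic_higher_has_deriv[OF df, of n]
      by (intro continuous_at_imp_continuous_on ballI DERIV_isCont) auto
    hence "closed {y. (deriv ^^ n) (deriv f) y = 0}" for n
      by (intro closed_Collect_eq) auto
    thus ?thesis unfolding Z_def by (intro closed_Collect_all)
  qed
  moreover have "x0 \<in> Z"
    using zero[of "Suc _"] by (simp add: Z_def funpow_Suc_right del: funpow.simps)
  ultimately have "Z = UNIV" using clopen by blast
  hence "(deriv ^^ 0) (deriv f) y = 0" for y
    unfolding Z_def by blast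
  hence "\<And>y. (f has_real_derivative 0) (at y)"
    using real_analytic_has_deriv[OF f] by simp
  thus ?thesis by (intro DERIV_isconst_all) auto
qed

section \<open>Oscillatory integrals\<close>

text \<open>Integration by parts. The derivative of \<open>G\<close>, the integrand divided by
  \<open>l * \<psi>1 x\<close>, is \<open>\<i>\<close> times the integrand minus \<open>E\<close>,
  where \<open>E\<close> comes from differentiating the denominator. The bound \<open>M\<close> on
  the second derivative takes the place of the usual monotonicity of \<open>\<psi>1\<close>.\<close>

lemma van_der_corput_first:
  fixes \<psi> \<psi>1 \<psi>2 :: "real \<Rightarrow> real"
  assumes "0 < \<eta>" "0 < l" "a \<le> b"
    and d1: "\<And>x. (\<psi> has_real_derivative \<psi>1 x) (at x)"
    and d2: "\<And>x. (\<psi>1 has_real_derivative \<psi>2 x) (at x)"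
    and cont: "continuous_on UNIV \<psi>2"
    and lower: "\<And>x. x \<in> {a..b} \<Longrightarrow> \<eta> \<le> \<bar>\<psi>1 x\<bar>"
    and upper: "\<And>x. x \<in> {a..b} \<Longrightarrow> \<bar>\<psi>2 x\<bar> \<le> M"
  shows "norm (integral {a..b} (\<lambda>x. cis (l * \<psi> x))) \<le> 2 / (l * \<eta>) + M * (b - a) / (l * \<eta>\<^sup>2)"
proof -
  define G where "G = (\<lambda>x. cis (l * \<psi> x) * complex_of_real (1 / (l * \<psi>1 x)))"
  define E where "E = (\<lambda>x. complex_of_real (\<psi>2 x / (l * (\<psi>1 x)\<^sup>2)) * cis (l * \<psi> x))"
  have c0: "continuous_on S \<psi>" "continuous_on S \<psi>1" "continuous_on S \<psi>2" for S
    using DERIV_isCont[OF d1] DERIV_isCont[OF d2] continuous_on_subset[OF cont]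
    by (auto intro: continuous_at_imp_continuous_on)
  have nz: "\<psi>1 x \<noteq> 0" if "x \<in> {a..b}" for x
    using lower[OF that] \<open>0 < \<eta>\<close> by auto
  have dG: "(G has_vector_derivative (\<i> * cis (l * \<psi> x) - E x)) (at x within {a..b})"
    if "x \<in> {a..b}" for x
  proof -
    have "((\<lambda>x. 1 / (l * \<psi>1 x)) has_real_derivative - (\<psi>2 x / (l * (\<psi>1 x)\<^sup>2))) (at x within {a..b})"
      by (rule derivative_eq_intros DERIV_subset[OF d2] refl subset_UNIV | use nz[OF that] \<open>0 < l\<close> in \<open>simp add: field_simps power2_eq_square\<close>)+
    hence 1: "((\<lambda>x. complex_of_real (1 / (l * \<psi>1 x))) has_vector_derivative
        complex_of_real (- (\<psi>2 x / (l * (\<psi>1 x)\<^sup>2)))) (at x within {a..b})"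
      by (intro has_vector_derivative_of_real) (simp add: has_real_derivative_iff_has_vector_derivative)
    have "((\<lambda>x. l * \<psi> x) has_real_derivative l * \<psi>1 x) (at x within {a..b})"
      by (intro DERIV_cmult DERIV_subset[OF d1] subset_UNIV)
    hence "((\<lambda>x. cis (l * \<psi> x)) has_derivative (\<lambda>t. ((l * \<psi>1 x) * t) *\<^sub>R (\<i> * cis (l * \<psi> x))))
        (at x within {a..b})"
      by (intro has_derivative_cis) (simp add: has_field_derivative_def)
    hence 2: "((\<lambda>x. cis (l * \<psi> x)) has_vector_derivative (l * \<psi>1 x) *\<^sub>R (\<i> * cis (l * \<psi> x)))
        (at x within {a..b})"
      by (simp add: has_vector_derivative_def mult_ac scaleR_conv_of_real)
    show ?thesis
      unfolding G_def E_def
      by (rule has_vector_derivative_eq_rhs[OF has_vector_derivative_mult[OF 2 1]])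
         (use nz[OF that] \<open>0 < l\<close> in \<open>simp add: scaleR_conv_of_real field_simps\<close>)
  qed
  have cE: "continuous_on {a..b} E"
    unfolding E_def using nz \<open>0 < l\<close> by (intro continuous_intros c0) auto
  have ccis: "continuous_on {a..b} (\<lambda>x. \<i> * cis (l * \<psi> x))"
    by (intro continuous_intros c0)
  have "((\<lambda>x. \<i> * cis (l * \<psi> x) - E x) has_integral (G b - G a)) {a..b}"
    using \<open>a \<le> b\<close> dG by (rule fundamental_theorem_of_calculus)
  hence "integral {a..b} (\<lambda>x. \<i> * cis (l * \<psi> x) - E x) = G b - G a"
    by blast
  hence eq: "\<i> * integral {a..b} (\<lambda>x. cis (l * \<psi> x)) = (G b - G a) + integral {a..b} E"
    by (subst (asm) integral_diff)
       (auto intro!: integrable_continuous_interval cE ccis continuous_intros c0 simp: algebra_simps)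
  have nG: "norm (G x) \<le> 1 / (l * \<eta>)" if "x \<in> {a..b}" for x
    using lower[OF that] \<open>0 < l\<close> \<open>0 < \<eta>\<close>
    by (simp add: G_def norm_mult norm_divide divide_simps)
  have nE: "norm (E x) \<le> M / (l * \<eta>\<^sup>2)" if "x \<in> {a..b}" for x
  proof -
    have "\<eta>\<^sup>2 \<le> (\<psi>1 x)\<^sup>2"
      using lower[OF that] \<open>0 < \<eta>\<close> by (intro abs_le_square_iff[THEN iffD1]) auto
    hence "\<bar>\<psi>2 x\<bar> / (l * (\<psi>1 x)\<^sup>2) \<le> M / (l * \<eta>\<^sup>2)"
      using upper[OF that] \<open>0 < l\<close> \<open>0 < \<eta>\<close> by (intro frac_le) auto
    thus ?thesis using \<open>0 < l\<close> by (simp add: E_def norm_mult norm_divide norm_power)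
  qed
  have "norm (integral {a..b} (\<lambda>x. cis (l * \<psi> x))) = norm ((G b - G a) + integral {a..b} E)"
    using arg_cong[OF eq, of norm] by (simp add: norm_mult)
  also have "\<dots> \<le> (norm (G b) + norm (G a)) + norm (integral {a..b} E)"
    by (rule norm_triangle_le) (intro add_right_mono norm_triangle_ineq4)
  also have "\<dots> \<le> (1 / (l * \<eta>) + 1 / (l * \<eta>)) + M / (l * \<eta>\<^sup>2) * (b - a)"
    using \<open>a \<le> b\<close> by (intro add_mono nG integral_bound cE nE) auto
  finally show ?thesis by (simp add: mult.commute)
qed

text \<open>By the mean value theorem \<open>g\<close> separates points at rate at least
  \<open>\<eta>\<close>. Take \<open>z\<close> minimising \<open>\<bar>g z\<bar>\<close>. Either
  \<open>g z = 0\<close>, or \<open>g\<close> keeps one sign, and then subtracting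
  \<open>g z\<close> from \<open>g x\<close> does not increase the modulus.\<close>

lemma abs_ge_dist_from_minimiser:
  fixes g g' :: "real \<Rightarrow> real"
  assumes "a \<le> b" "0 < \<eta>"
    and d: "\<And>x. (g has_real_derivative g' x) (at x)"
    and lower: "\<And>x. x \<in> {a..b} \<Longrightarrow> \<eta> \<le> \<bar>g' x\<bar>"
  obtains z where "z \<in> {a..b}" "\<And>x. x \<in> {a..b} \<Longrightarrow> \<eta> * \<bar>x - z\<bar> \<le> \<bar>g x\<bar>"
proof -
  have cont: "continuous_on S g" for S
    using DERIV_isCont[OF d] by (auto intro: continuous_at_imp_continuous_on)
  have "\<exists>z\<in>{a..b}. \<forall>y\<in>{a..b}. \<bar>g z\<bar> \<le> \<bar>g y\<bar>"
    using \<open>a \<le> b\<close> by (intro continuous_attains_inf continuous_intros cont) auto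
  then obtain z where z: "z \<in> {a..b}" and min: "\<And>y. y \<in> {a..b} \<Longrightarrow> \<bar>g z\<bar> \<le> \<bar>g y\<bar>"
    by blast
  have expand: "\<eta> * (y - x) \<le> \<bar>g y - g x\<bar>" if "a \<le> x" "x < y" "y \<le> b" for x y
  proof -
    obtain t where "x < t" "t < y" "g y - g x = (y - x) * g' t"
      using MVT2[OF \<open>x < y\<close>, of g g'] d by blast
    thus ?thesis using lower[of t] that by (simp add: abs_mult mult.commute mult_left_mono)
  qed
  have expand': "\<eta> * \<bar>x - z\<bar> \<le> \<bar>g x - g z\<bar>" if "x \<in> {a..b}" for x
    using expand[of x z] expand[of z x] that z by (cases x z rule: linorder_cases) (auto simp: abs_minus_commute)
  have "\<eta> * \<bar>x - z\<bar> \<le> \<bar>g x\<bar>" if x: "x \<in> {a..b}" for x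
  proof (cases "g z = 0")
    case True
    thus ?thesis using expand'[OF x] by simp
  next
    case False
    have nz: "g y \<noteq> 0" if "y \<in> {a..b}" for y
      using min[OF that] False by auto
    have "g x * g z > 0"
    proof (rule ccontr)
      assume "\<not> g x * g z > 0"
      hence opp: "(g x < 0 \<and> g z > 0) \<or> (g x > 0 \<and> g z < 0)"
        using nz[OF x] nz[OF z] by (auto simp: zero_less_mult_iff not_less)
      have conv: "closed_segment x z \<subseteq> {a..b}"
        using x z by (auto simp: closed_segment_eq_real_ivl)
      have "connected (g ` closed_segment x z)"
        by (intro connected_continuous_image cont) auto
      hence "0 \<in> g ` closed_segment x z"
        using opp connectedD_interval[of "g ` closed_segment x z" "g x" "g z" 0]
          connectedD_interval[of "g ` closed_segment x z" "g z" "g x" 0] by auto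
      thus False using conv nz by auto
    qed
    hence "\<bar>g x - g z\<bar> \<le> \<bar>g x\<bar>"
      using min[OF x] by (auto simp: zero_less_mult_iff)
    thus ?thesis using expand'[OF x] by linarith
  qed
  thus ?thesis using that z by blast
qed

text \<open>Induction on the order of the derivative that is bounded below. Let \<open>z\<close>
  come from the preceding lemma for \<open>D (Suc j)\<close>. At distance at least \<open>d\<close>
  from \<open>z\<close> this derivative has modulus at least \<open>\<eta> * d\<close>, so the
  induction hypothesis applies on either side; the stretch in between has length at most
  \<open>2 * d\<close>. Three pieces at each stage give the factor \<open>3 ^ j\<close>. Fixing
  \<open>{p..q}\<close> and \<open>L\<close> keeps the constants of the base case the same for all
  subintervals, and \<open>d\<close> is left to be optimised later.\<close>

lemma van_der_corput:
  fixes D :: "nat \<Rightarrow> real \<Rightarrow> real"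
  assumes "0 < l" "0 < d" "d \<le> 1" "0 \<le> M" "0 \<le> L"
    and der: "\<And>n x. (D n has_real_derivative D (Suc n) x) (at x)"
    and "\<And>x. x \<in> {p..q} \<Longrightarrow> \<bar>D 2 x\<bar> \<le> M"
    and "0 < \<eta>" "\<eta> \<le> 1" "a \<le> b" "{a..b} \<subseteq> {p..q}" "b - a \<le> L"
    and "\<And>x. x \<in> {a..b} \<Longrightarrow> \<eta> \<le> \<bar>D (Suc j) x\<bar>"
  shows "norm (integral {a..b} (\<lambda>x. cis (l * D 0 x))) \<le>
           3 ^ j * ((2 + M * L) / (l * (\<eta> * d ^ j)\<^sup>2) + 3 * d)"
  using assms(8-)
proof (induction j arbitrary: \<eta> a b)
  case 0
  have "\<bar>D 2 x\<bar> \<le> M" if "x \<in> {a..b}" for x using assms(7) that 0 by blast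
  hence "norm (integral {a..b} (\<lambda>x. cis (l * D 0 x))) \<le> 2 / (l * \<eta>) + M * (b - a) / (l * \<eta>\<^sup>2)"
    using 0 der[of 0] der[of 1] DERIV_isCont[OF der[of 2]] \<open>0 < l\<close>
    by (intro van_der_corput_first[of _ _ _ _ _ "D 1" "D 2"])
       (auto simp: numeral_2_eq_2 intro: continuous_at_imp_continuous_on)
  also have "\<dots> \<le> 2 / (l * \<eta>\<^sup>2) + M * L / (l * \<eta>\<^sup>2)"
    using 0 \<open>0 < l\<close> \<open>0 \<le> M\<close>
    by (intro add_mono divide_left_mono divide_right_mono mult_left_mono mult_pos_pos)
       (auto simp: power2_eq_square mult_left_le)
  finally show ?case using \<open>0 < d\<close> by (simp add: add_divide_distrib)
next
  case (Suc j)
  let ?I = "\<lambda>a b. integral {a..b} (\<lambda>x. cis (l * D 0 x))"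
  \<comment> \<open>The bound of the induction hypothesis with \<open>\<eta> * d\<close> in place of
    \<open>\<eta>\<close>.\<close>
  define B where "B = 3 ^ j * ((2 + M * L) / (l * (\<eta> * d ^ Suc j)\<^sup>2) + 3 * d)"
  have B0: "B \<ge> 0" unfolding B_def using \<open>0 < l\<close> \<open>0 < d\<close> \<open>0 \<le> M\<close> \<open>0 \<le> L\<close> by simp
  obtain z where z: "z \<in> {a..b}" "\<And>x. x \<in> {a..b} \<Longrightarrow> \<eta> * \<bar>x - z\<bar> \<le> \<bar>D (Suc j) x\<bar>"
    using abs_ge_dist_from_minimiser[OF Suc.prems(3,1) der[of "Suc j"] Suc.prems(6)] by blast
  have piece: "norm (?I s t) \<le> B"
    if "s \<le> t" "a \<le> s" "t \<le> b" "\<And>x. x \<in> {s..t} \<Longrightarrow> d \<le> \<bar>x - z\<bar>" for s t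
  proof -
    have "norm (?I s t) \<le> 3 ^ j * ((2 + M * L) / (l * ((\<eta> * d) * d ^ j)\<^sup>2) + 3 * d)"
    proof (rule Suc.IH)
      show "\<eta> * d \<le> 1" using Suc.prems \<open>0 < d\<close> \<open>d \<le> 1\<close> by (simp add: mult_le_one)
      show "\<eta> * d \<le> \<bar>D (Suc j) x\<bar>" if "x \<in> {s..t}" for x
      proof -
        have "\<eta> * d \<le> \<eta> * \<bar>x - z\<bar>"
          using \<open>\<And>x. x \<in> {s..t} \<Longrightarrow> d \<le> \<bar>x - z\<bar>\<close>[OF that] Suc.prems by (intro mult_left_mono) auto
        also have "\<dots> \<le> \<bar>D (Suc j) x\<bar>" using z(2)[of x] that \<open>a \<le> s\<close> \<open>t \<le> b\<close> by auto
        finally show ?thesis .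
      qed
    qed (use Suc.prems that \<open>0 < d\<close> in auto)
    thus ?thesis by (simp add: B_def mult.assoc)
  qed
  \<comment> \<open>The cuts are clipped to \<open>{a..b}\<close>. A side piece may then be a single
    point, where nonnegativity of \<open>B\<close> suffices.\<close>
  define s where "s = max a (z - d)"
  define t where "t = min b (z + d)"
  have st: "a \<le> s" "s \<le> t" "t \<le> b" "t - s \<le> 2 * d"
    using z \<open>0 < d\<close> \<open>a \<le> b\<close> by (auto simp: s_def t_def)
  have c: "continuous_on S (\<lambda>x. cis (l * D 0 x))" for S
    using DERIV_isCont[OF der[of 0]]
    by (intro continuous_intros continuous_at_imp_continuous_on) auto
  have left: "norm (?I a s) \<le> B"
    using piece[of a s] st B0 by (cases "a < z - d") (auto simp: s_def)
  have right: "norm (?I t b) \<le> B"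
    using piece[of t b] st B0 by (cases "z + d < b") (auto simp: t_def)
  have mid: "norm (?I s t) \<le> 1 * (t - s)"
    using st by (intro integral_bound c) auto
  have "?I a b = ?I a s + ?I s b"
    using st by (intro Henstock_Kurzweil_Integration.integral_combine[symmetric] integrable_continuous_interval c) auto
  moreover have "?I s b = ?I s t + ?I t b"
    using st by (intro Henstock_Kurzweil_Integration.integral_combine[symmetric] integrable_continuous_interval c) auto
  ultimately have split: "?I a b = ?I a s + (?I s t + ?I t b)" by simp
  have "norm (?I a b) \<le> norm (?I a s) + (norm (?I s t) + norm (?I t b))"
    unfolding split by (rule norm_triangle_le) (intro add_left_mono norm_triangle_ineq)
  also have "\<dots> \<le> B + (2 * d + B)"
  proof (intro add_mono left right)
    show "norm (?I s t) \<le> 2 * d" using mid st(4) by simp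
  qed
  also have "\<dots> \<le> 3 * B"
  proof -
    \<comment> \<open>The summand \<open>3 * d\<close> inside \<open>B\<close> absorbs the middle
      piece.\<close>
    have "2 * d \<le> 1 * (0 + 3 * d)" using \<open>0 < d\<close> by simp
    also have "\<dots> \<le> B"
      unfolding B_def using \<open>0 < l\<close> \<open>0 < d\<close> \<open>0 \<le> M\<close> \<open>0 \<le> L\<close> by (intro mult_mono add_mono) auto
    finally show ?thesis by simp
  qed
  finally show ?case by (simp add: B_def)
qed

section \<open>Decay estimates uniform in the direction of the coefficient vector\<close>

text \<open>Compactness of the sphere makes nonvanishing quantitative. The single number
  \<open>n\<close> bounds both the order and the reciprocal of the lower bound, so the open sets
  \<open>U n\<close> grow with \<open>n\<close> and a finite subcover sits inside one of
  them.\<close>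

lemma some_derivative_bounded_below_on_sphere:
  fixes f :: "'k::finite \<Rightarrow> real \<Rightarrow> real"
  assumes analytic: "\<And>i. real_analytic (f i)" and indep: "lin_indep_with_one f"
  obtains n :: nat where "n \<ge> 1"
    "\<And>u :: real ^ 'k. norm u = 1 \<Longrightarrow>
       \<exists>j\<in>{1..n}. 1 / real n < \<bar>\<Sum>i\<in>UNIV. u $ i * (deriv ^^ j) (f i) x0\<bar>"
proof -
  define P where "P = (\<lambda>j (u :: real ^ 'k). \<bar>\<Sum>i\<in>UNIV. u $ i * (deriv ^^ j) (f i) x0\<bar>)"
  define U where "U = (\<lambda>n. \<Union>j\<in>{1..n}. {u. 1 / real n < P j u})"
  have "open (U n)" for n
    unfolding U_def P_def by (intro open_UN ballI open_Collect_less continuous_intros)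
  moreover have "sphere 0 1 \<subseteq> (\<Union>n\<in>UNIV. U n)"
  proof
    fix u :: "real ^ 'k" assume "u \<in> sphere 0 1"
    hence "u \<noteq> 0" by auto
    have "\<exists>j\<ge>1. P j u \<noteq> 0"
    proof (rule ccontr)
      assume "\<not> ?thesis"
      hence zero: "\<And>j. j \<ge> 1 \<Longrightarrow> (\<Sum>i\<in>UNIV. u $ i * (deriv ^^ j) (f i) x0) = 0"
        by (auto simp: P_def)
      define g where "g = (\<lambda>x. \<Sum>i\<in>UNIV. u $ i * f i x)"
      have "g x = g x0" for x
      proof (rule real_analytic_const_if_derivs_zero[where f = g])
        show "real_analytic g"
          unfolding g_def by (intro real_analytic_linear_combination analytic)
        show "(deriv ^^ n) g x0 = 0" if "n \<ge> 1" for n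
          using zero[OF that] unfolding g_def
          by (subst higher_deriv_linear_combination[OF analytic])
      qed
      \<comment> \<open>The negated constant value becomes the coefficient of the function 1 in a
        vanishing combination.\<close>
      hence "\<forall>x. - g x0 * 1 + (\<Sum>i\<in>UNIV. u $ i * f i x) = 0"
        by (simp add: g_def)
      hence "\<forall>i. u $ i = 0"
        using indep unfolding lin_indep_with_one_def by blast
      thus False using \<open>u \<noteq> 0\<close> by (simp add: vec_eq_iff)
    qed
    then obtain j where j: "j \<ge> 1" "P j u > 0"
      by (auto simp: P_def)
    obtain m where m: "inverse (of_nat (Suc m)) < P j u" using reals_Archimedean[OF j(2)] by blast
    have "1 / real (max j (Suc m)) \<le> inverse (of_nat (Suc m))"
      unfolding inverse_eq_divide by (intro divide_left_mono) auto
    hence "u \<in> U (max j (Suc m))" using m j by (auto simp: U_def intro!: bexI[of _ j])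
    thus "u \<in> (\<Union>n\<in>UNIV. U n)" by blast
  qed
  ultimately obtain C where C: "finite C" "sphere 0 1 \<subseteq> (\<Union>n\<in>C. U n)"
    using compactE_image[OF compact_sphere, of UNIV U "0::real^'k" 1] by metis
  define n where "n = Max (insert 1 C)"
  have "n \<ge> 1" using C by (simp add: n_def)
  moreover have "\<exists>j\<in>{1..n}. 1 / real n < P j u" if "norm u = 1" for u
  proof -
    have "u \<in> sphere 0 1" using that by simp
    then obtain m where m: "m \<in> C" "u \<in> U m" using C by blast
    then obtain j where j: "j \<in> {1..m}" "1 / real m < P j u" by (auto simp: U_def)
    have "m \<le> n" using m C by (auto simp: n_def intro: Max_ge)
    have "1 / real n \<le> 1 / real m" using j \<open>m \<le> n\<close> by (intro divide_left_mono) auto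
    hence "1 / real n < P j u" using j by linarith
    thus ?thesis using j \<open>m \<le> n\<close> by auto
  qed
  ultimately show ?thesis using that unfolding P_def by blast
qed

text \<open>Split \<open>c\<close> into its norm \<open>l\<close> and a unit vector
  \<open>u\<close>. Continuity carries the lower bound from \<open>x0\<close> to an interval that
  does not depend on \<open>u\<close>, and van der Corput is applied there with a negative power of
  \<open>l\<close> as \<open>d\<close>. The exponent depends on \<open>f\<close> and
  \<open>x0\<close>.\<close>

lemma oscillatory_integral_decay:
  fixes f :: "'k::finite \<Rightarrow> real \<Rightarrow> real"
  assumes analytic: "\<And>i. real_analytic (f i)" and indep: "lin_indep_with_one f"
  obtains p q C \<delta> where "p < x0" "x0 < q" "0 \<le> C" "0 < \<delta>" "\<delta> \<le> 1"
    "\<And>c :: real ^ 'k. norm c \<ge> 1 \<Longrightarrow>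
       norm (integral {p..q} (\<lambda>x. cis (\<Sum>i\<in>UNIV. c $ i * f i x))) \<le> C * norm c powr (-\<delta>)"
proof -
  obtain n :: nat where n: "n \<ge> 1" and big: "\<And>u :: real ^ 'k. norm u = 1 \<Longrightarrow>
       \<exists>j\<in>{1..n}. 1 / real n < \<bar>\<Sum>i\<in>UNIV. u $ i * (deriv ^^ j) (f i) x0\<bar>"
    using some_derivative_bounded_below_on_sphere[OF analytic indep, of x0] by blast
  \<comment> \<open>Coordinates of a unit vector have modulus at most 1, so the
    \<open>CARD('k)\<close> terms together change by at most half of the lower bound
    \<open>1 / real n\<close>.\<close>
  define e where "e = 1 / (2 * real n * CARD('k))"
  have "e > 0" using n by (simp add: e_def)
  have isCont: "isCont ((deriv ^^ j) (f i)) x" for i j x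
    using real_analytic_higher_has_deriv[OF analytic] by (rule DERIV_isCont)
  hence cont: "continuous_on S ((deriv ^^ j) (f i))" for i j S
    by (intro continuous_at_imp_continuous_on) auto
  have "\<forall>\<^sub>F x in nhds x0. dist ((deriv ^^ j) (f i) x) ((deriv ^^ j) (f i) x0) < e" for i j
    using tendstoD[OF isCont[unfolded isCont_def tendsto_at_iff_tendsto_nhds] \<open>e > 0\<close>] .
  hence "\<forall>\<^sub>F x in nhds x0. \<forall>i. \<forall>j\<in>{1..n}.
           dist ((deriv ^^ j) (f i) x) ((deriv ^^ j) (f i) x0) < e"
    by (intro eventually_all_finite eventually_ball_finite) auto
  then obtain \<rho> where \<rho>: "\<rho> > 0" and near: "\<And>x i j. dist x x0 < \<rho> \<Longrightarrow> j \<in> {1..n} \<Longrightarrow>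
      dist ((deriv ^^ j) (f i) x) ((deriv ^^ j) (f i) x0) < e"
    unfolding eventually_nhds_metric by blast
  \<comment> \<open>Half of \<open>\<rho>\<close> keeps the closed interval inside the ball and
    makes its length \<open>\<rho>\<close>.\<close>
  define p where "p = x0 - \<rho> / 2"
  define q where "q = x0 + \<rho> / 2"
  have lower: "\<exists>j\<in>{1..n}. \<forall>x\<in>{p..q}. 1 / (2 * real n) \<le> \<bar>\<Sum>i\<in>UNIV. u $ i * (deriv ^^ j) (f i) x\<bar>"
    if u: "norm u = 1" for u :: "real ^ 'k"
  proof -
    obtain j where j: "j \<in> {1..n}" "1 / real n < \<bar>\<Sum>i\<in>UNIV. u $ i * (deriv ^^ j) (f i) x0\<bar>"
      using big[OF u] by blast
    have "1 / (2 * real n) \<le> \<bar>\<Sum>i\<in>UNIV. u $ i * (deriv ^^ j) (f i) x\<bar>" if x: "x \<in> {p..q}" for x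
    proof -
      let ?A = "\<Sum>i\<in>UNIV. u $ i * (deriv ^^ j) (f i) x"
      let ?B = "\<Sum>i\<in>UNIV. u $ i * (deriv ^^ j) (f i) x0"
      have "dist x x0 < \<rho>" using x \<rho> by (auto simp: p_def q_def dist_real_def)
      have "\<bar>?A - ?B\<bar> = \<bar>\<Sum>i\<in>UNIV. u $ i * ((deriv ^^ j) (f i) x - (deriv ^^ j) (f i) x0)\<bar>"
        by (simp add: sum_subtractf right_diff_distrib)
      also have "\<dots> \<le> (\<Sum>i\<in>(UNIV :: 'k set). 1 * e)"
      proof (rule order_trans[OF sum_abs], rule sum_mono)
        fix i
        show "\<bar>u $ i * ((deriv ^^ j) (f i) x - (deriv ^^ j) (f i) x0)\<bar> \<le> 1 * e"
          using near[OF \<open>dist x x0 < \<rho>\<close> j(1), of i] component_le_norm_cart[of u i] u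
          unfolding abs_mult by (intro mult_mono) (auto simp: dist_real_def)
      qed
      also have "\<dots> = 1 / (2 * real n)" using n by (simp add: e_def)
      finally have "\<bar>?A - ?B\<bar> \<le> 1 / (2 * real n)" .
      moreover have "1 / real n = 1 / (2 * real n) + 1 / (2 * real n)" by simp
      ultimately show ?thesis using j(2) by linarith
    qed
    thus ?thesis using j(1) by blast
  qed
  have "\<exists>M. \<forall>x\<in>{p..q}. \<bar>(deriv ^^ 2) (f i) x\<bar> \<le> M" for i
    using compact_imp_bounded[OF compact_continuous_image[OF cont[where i=i and j=2 and S="{p..q}"] compact_Icc]]
    by (auto simp: bounded_iff)
  then obtain M where M: "\<And>i x. x \<in> {p..q} \<Longrightarrow> \<bar>(deriv ^^ 2) (f i) x\<bar> \<le> M i" by metis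
  \<comment> \<open>This number is the lower bound for the derivative and at the same time the decay
    exponent.\<close>
  define \<eta> where "\<eta> = 1 / (2 * real n)"
  define K where "K = (\<Sum>i\<in>UNIV. \<bar>M i\<bar>)"
  define C where "C = 3 ^ n * ((2 + K * \<rho>) / \<eta>\<^sup>2 + 3)"
  have \<eta>: "0 < \<eta>" "\<eta> \<le> 1" using n by (auto simp: \<eta>_def)
  have K: "K \<ge> 0" by (simp add: K_def sum_nonneg)
  have bound: "norm (integral {p..q} (\<lambda>x. cis (\<Sum>i\<in>UNIV. c $ i * f i x))) \<le> C * norm c powr (-\<eta>)"
    if c: "norm c \<ge> 1" for c :: "real ^ 'k"
  proof -
    define l where "l = norm c"
    define u where "u = c /\<^sub>R l"
    define D where "D = (\<lambda>m x. \<Sum>i\<in>UNIV. u $ i * (deriv ^^ m) (f i) x)"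
    \<comment> \<open>With this choice both summands of the van der Corput bound are at most
      multiples of \<open>d\<close>: the first because
      \<open>\<eta> * real (2 * m + 1) \<le> 1\<close>, so that \<open>l * (d ^ m)\<^sup>2\<close>
      is at least \<open>l powr \<eta>\<close>.\<close>
    define d where "d = l powr (-\<eta>)"
    have l: "l \<ge> 1" using c by (simp add: l_def)
    have "norm u = 1" using l by (auto simp: u_def l_def intro!: left_inverse)
    then obtain j where j: "j \<in> {1..n}" "\<And>x. x \<in> {p..q} \<Longrightarrow> \<eta> \<le> \<bar>D j x\<bar>"
      using lower unfolding \<eta>_def D_def by blast
    then obtain m where m: "j = Suc m" "m < n" by (cases j) auto
    have d: "0 < d" "d \<le> 1" using l \<eta> by (auto simp: d_def powr_minus_divide divide_simps ge_one_powr_ge_zero)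
    have "norm (integral {p..q} (\<lambda>x. cis (l * D 0 x))) \<le>
           3 ^ m * ((2 + K * \<rho>) / (l * (\<eta> * d ^ m)\<^sup>2) + 3 * d)"
    proof (rule van_der_corput[where p = p and q = q])
      show "(D n has_real_derivative D (Suc n) x) (at x)" for n x
        unfolding D_def by (intro DERIV_sum DERIV_cmult real_analytic_higher_has_deriv analytic)
      show "\<bar>D 2 x\<bar> \<le> K" if "x \<in> {p..q}" for x
        unfolding D_def K_def
      proof (rule order_trans[OF sum_abs], rule sum_mono)
        fix i
        have "\<bar>(deriv ^^ 2) (f i) x\<bar> \<le> \<bar>M i\<bar>" using M[OF that, of i] by linarith
        hence "\<bar>u $ i\<bar> * \<bar>(deriv ^^ 2) (f i) x\<bar> \<le> 1 * \<bar>M i\<bar>"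
          using component_le_norm_cart[of u i] \<open>norm u = 1\<close> by (intro mult_mono) auto
        thus "\<bar>u $ i * (deriv ^^ 2) (f i) x\<bar> \<le> \<bar>M i\<bar>" by (simp add: abs_mult)
      qed
    qed (use l d \<eta> K \<rho> j m in \<open>auto simp: p_def q_def\<close>)
    also have "\<dots> \<le> 3 ^ n * ((2 + K * \<rho>) / \<eta>\<^sup>2 * d + 3 * d)"
    proof (intro mult_mono add_mono order_refl)
      have dpow: "d ^ r = l powr (- (\<eta> * real r))" for r
        using l by (simp add: d_def powr_power mult.commute)
      have "l powr \<eta> \<le> l powr (1 - 2 * \<eta> * real m)"
      proof (rule powr_mono)
        have "\<eta> * real (Suc (2 * m)) \<le> \<eta> * real (2 * n)"
          using m \<eta> by (intro mult_left_mono) auto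
        thus "\<eta> \<le> 1 - 2 * \<eta> * real m" using n by (simp add: \<eta>_def field_simps)
      qed (use l in auto)
      also have "\<dots> = l * (d ^ m)\<^sup>2"
        using l by (simp add: dpow powr_diff powr_minus_divide power2_eq_square field_simps
            flip: powr_add)
      finally have "\<eta>\<^sup>2 * l powr \<eta> \<le> l * (\<eta> * d ^ m)\<^sup>2"
        using \<eta> by (simp add: power_mult_distrib mult_ac)
      hence "(2 + K * \<rho>) / (l * (\<eta> * d ^ m)\<^sup>2) \<le> (2 + K * \<rho>) / (\<eta>\<^sup>2 * l powr \<eta>)"
        using l \<eta> K \<rho> d by (intro divide_left_mono mult_pos_pos) auto
      thus "(2 + K * \<rho>) / (l * (\<eta> * d ^ m)\<^sup>2) \<le> (2 + K * \<rho>) / \<eta>\<^sup>2 * d"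
        by (simp add: d_def powr_minus_divide)
    qed (use m l d \<eta> K \<rho> in auto)
    also have "\<dots> = C * l powr (-\<eta>)" by (simp add: C_def d_def algebra_simps)
    also have "(\<lambda>x. cis (l * D 0 x)) = (\<lambda>x. cis (\<Sum>i\<in>UNIV. c $ i * f i x))"
      using l by (simp add: D_def u_def sum_distrib_left mult.assoc[symmetric])
    finally show ?thesis by (simp add: l_def)
  qed
  show ?thesis
    by (rule that[of p q C \<eta>]) (use \<rho> \<eta> K bound in \<open>auto simp: p_def q_def C_def\<close>)
qed

section \<open>Weyl's criterion\<close>

definition has_mean :: "(nat \<Rightarrow> complex) \<Rightarrow> complex \<Rightarrow> bool" where
  "has_mean z L \<longleftrightarrow> (\<lambda>N. (\<Sum>n\<in>{1..N}. z n) / of_nat N) \<longlonglongrightarrow> L"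

lemma has_mean_add: "has_mean z L \<Longrightarrow> has_mean z' L' \<Longrightarrow> has_mean (\<lambda>n. z n + z' n) (L + L')"
  unfolding has_mean_def using tendsto_add by (force simp: sum.distrib add_divide_distrib)

lemma has_mean_cmult: "has_mean z L \<Longrightarrow> has_mean (\<lambda>n. c * z n) (c * L)"
  unfolding has_mean_def using tendsto_mult_left by (force simp flip: sum_distrib_left)

lemma has_mean_one: "has_mean (\<lambda>n. 1) 1"
  unfolding has_mean_def
proof (rule tendsto_eventually)
  show "\<forall>\<^sub>F N in sequentially. (\<Sum>n\<in>{1..N}. 1::complex) / of_nat N = 1"
    using eventually_gt_at_top[of 0] by eventually_elim simp
qed

text \<open>Serves both approximations below: of continuous functions by trigonometric polynomials,
  and of indicators by continuous functions. The mean of the approximant varies with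
  \<open>e\<close>, hence the separate tolerance \<open>K * e\<close> for the limits.\<close>

lemma has_mean_approx:
  assumes "K \<ge> 0"
    and approx: "\<And>e. e > 0 \<Longrightarrow> \<exists>z' L'. has_mean z' L' \<and> norm (L - L') \<le> K * e \<and>
      (\<forall>\<^sub>F N in sequentially. norm ((\<Sum>n\<in>{1..N}. z n - z' n) / of_nat N) \<le> e)"
  shows "has_mean z L"
  unfolding has_mean_def
proof (rule tendstoI)
  fix e :: real assume "e > 0"
  \<comment> \<open>The errors \<open>d\<close>, \<open>d\<close> and \<open>K * d\<close> add up to
    \<open>e\<close>.\<close>
  define d where "d = e / (K + 2)"
  have d: "d > 0" "(K + 2) * d = e" using \<open>e > 0\<close> \<open>K \<ge> 0\<close> by (auto simp: d_def)
  obtain z' L' where z': "has_mean z' L'" "norm (L - L') \<le> K * d"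
    "\<forall>\<^sub>F N in sequentially. norm ((\<Sum>n\<in>{1..N}. z n - z' n) / of_nat N) \<le> d"
    using approx[OF d(1)] by blast
  have "\<forall>\<^sub>F N in sequentially. dist ((\<Sum>n\<in>{1..N}. z' n) / of_nat N) L' < d"
    using z'(1) d(1) unfolding has_mean_def by (rule tendstoD)
  with z'(3) show "\<forall>\<^sub>F N in sequentially. dist ((\<Sum>n\<in>{1..N}. z n) / of_nat N) L < e"
  proof eventually_elim
    case (elim N)
    have "dist ((\<Sum>n\<in>{1..N}. z n) / of_nat N) L \<le>
      dist ((\<Sum>n\<in>{1..N}. z n) / of_nat N) ((\<Sum>n\<in>{1..N}. z' n) / of_nat N) +
      (dist ((\<Sum>n\<in>{1..N}. z' n) / of_nat N) L' + dist L' L)"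
      by (meson add_left_mono dist_triangle order_trans)
    also have "dist ((\<Sum>n\<in>{1..N}. z n) / of_nat N) ((\<Sum>n\<in>{1..N}. z' n) / of_nat N) \<le> d"
      using elim(1) by (simp add: dist_norm sum_subtractf diff_divide_distrib)
    also have "dist L' L \<le> K * d" using z'(2) by (simp add: dist_norm norm_minus_commute)
    finally have "dist ((\<Sum>n\<in>{1..N}. z n) / of_nat N) L < d + (d + K * d)"
      using elim(2) by linarith
    also have "\<dots> = e" using d(2) by (simp add: algebra_simps)
    finally show ?case .
  qed
qed

lemma norm_mean_le:
  fixes z :: "nat \<Rightarrow> complex"
  assumes "\<And>n. norm (z n) \<le> e" "e \<ge> 0"
  shows "norm ((\<Sum>n\<in>{1..N}. z n) / of_nat N) \<le> e"
proof (cases "N = 0")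
  case False
  have "norm (\<Sum>n\<in>{1..N}. z n) \<le> real N * e"
    using sum_norm_bound[of "{1..N}" z e] assms by simp
  thus ?thesis using False by (simp add: norm_divide divide_simps mult.commute)
qed (use assms in auto)

section \<open>Trigonometric polynomials and continuous functions on the circle\<close>

text \<open>Generated by characters and sums, so that linear statements about means and integrals
  follow by induction on the construction.\<close>

inductive trig_polynomial :: "(real \<Rightarrow> complex) \<Rightarrow> bool" where
  char: "trig_polynomial (\<lambda>t. c * cis (2 * pi * of_int h * t))"
| add: "trig_polynomial p \<Longrightarrow> trig_polynomial q \<Longrightarrow> trig_polynomial (\<lambda>t. p t + q t)"

lemma trig_polynomial_const: "trig_polynomial (\<lambda>t. c)"
  using trig_polynomial.char[of c 0] by simp

lemma trig_polynomial_char_mult: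
  "trig_polynomial p \<Longrightarrow> trig_polynomial (\<lambda>t. (c * cis (2 * pi * of_int h * t)) * p t)"
proof (induction rule: trig_polynomial.induct)
  case (char c' h')
  have "trig_polynomial (\<lambda>t. (c * c') * cis (2 * pi * of_int (h + h') * t))"
    by (rule trig_polynomial.char)
  thus ?case by (simp add: algebra_simps flip: cis_mult)
next
  case (add p q)
  thus ?case using trig_polynomial.add by (force simp: algebra_simps)
qed

lemma trig_polynomial_mult:
  "trig_polynomial p \<Longrightarrow> trig_polynomial q \<Longrightarrow> trig_polynomial (\<lambda>t. p t * q t)"
proof (induction rule: trig_polynomial.induct)
  case (char c h)
  thus ?case by (rule trig_polynomial_char_mult)
next
  case (add p p')
  thus ?case using trig_polynomial.add by (force simp: algebra_simps)
qed

text \<open>On the circle a real linear form is a combination of \<open>cis\<close> and its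
  conjugate, and trigonometric polynomials are closed under products. Polynomial approximation in
  the plane thus becomes trigonometric approximation.\<close>

lemma trig_polynomial_real_polynomial_function:
  fixes P :: "complex \<Rightarrow> real"
  assumes "real_polynomial_function P"
  shows "trig_polynomial (\<lambda>t. complex_of_real (P (cis (2 * pi * t))))"
  using assms
proof induction
  case (linear P)
  then interpret bounded_linear P .
  \<comment> \<open>Euler's formulas for \<open>cos\<close> and \<open>sin\<close>; a real linear
    form is determined by its values at 1 and \<open>\<i>\<close>.\<close>
  have eq: "complex_of_real (P (cis (2 * pi * t))) =
      (of_real (P 1) - \<i> * of_real (P \<i>)) / 2 * cis (2 * pi * of_int 1 * t) +
      (of_real (P 1) + \<i> * of_real (P \<i>)) / 2 * cis (2 * pi * of_int (- 1) * t)" for t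
  proof -
    have "cis (2 * pi * t) = cos (2 * pi * t) *\<^sub>R 1 + sin (2 * pi * t) *\<^sub>R \<i>"
      by (simp add: complex_eq_iff)
    hence "P (cis (2 * pi * t)) = cos (2 * pi * t) * P 1 + sin (2 * pi * t) * P \<i>"
      by (simp only: add scaleR) simp
    thus ?thesis by (simp add: complex_eq_iff field_simps)
  qed
  show ?case unfolding eq by (intro trig_polynomial.intros)
qed (auto intro: trig_polynomial_const trig_polynomial.add trig_polynomial_mult)

lemma has_integral_cis_period:
  assumes "h \<noteq> 0"
  shows "((\<lambda>t. cis (2 * pi * of_int h * t)) has_integral 0) {0..1}"
proof -
  define r where "r = 2 * pi * of_int h"
  have "r \<noteq> 0" using assms by (simp add: r_def)
  have "((\<lambda>t. cis (r * t)) has_integral (- \<i> / of_real r * cis (r * 1) - (- \<i> / of_real r * cis (r * 0)))) {0..1}"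
  proof (rule fundamental_theorem_of_calculus)
    fix t :: real assume "t \<in> {0..1}"
    have "((\<lambda>t. cis (r * t)) has_derivative (\<lambda>u. (r * u) *\<^sub>R (\<i> * cis (r * t)))) (at t within {0..1})"
      by (intro has_derivative_cis derivative_intros)
    hence "((\<lambda>t. cis (r * t)) has_vector_derivative (r *\<^sub>R (\<i> * cis (r * t)))) (at t within {0..1})"
      by (simp add: has_vector_derivative_def mult_ac)
    hence "((\<lambda>t. - \<i> / of_real r * cis (r * t)) has_vector_derivative
        (- \<i> / of_real r * (r *\<^sub>R (\<i> * cis (r * t))))) (at t within {0..1})"
      by (rule has_vector_derivative_mult_right)
    thus "((\<lambda>t. - \<i> / of_real r * cis (r * t)) has_vector_derivative cis (r * t)) (at t within {0..1})"
      using \<open>r \<noteq> 0\<close> by (simp add: scaleR_conv_of_real)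
  qed simp
  thus ?thesis by (simp add: r_def cis_multiple_2pi)
qed

text \<open>The weight \<open>w\<close> is to carry the factors of the other coordinates. Only the
  constant character contributes, with \<open>L\<close> as the mean of the weights.\<close>

lemma trig_polynomial_has_mean:
  assumes "trig_polynomial p"
    and "\<And>h :: int. has_mean (\<lambda>n. cis (2 * pi * of_int h * y n) * w n) (if h = 0 then L else 0)"
  shows "\<exists>I. (p has_integral I) {0..1} \<and> has_mean (\<lambda>n. p (y n) * w n) (I * L)"
  using assms(1)
proof induction
  case (char c h)
  have "((\<lambda>t. c * cis (2 * pi * of_int h * t)) has_integral (if h = 0 then c else 0)) {0..1}"
    using has_integral_mult_right[OF has_integral_cis_period[of h], of c]
      has_integral_const_real[of c 0 1] by (cases "h = 0") auto
  moreover have "has_mean (\<lambda>n. (c * cis (2 * pi * of_int h * y n)) * w n) ((if h = 0 then c else 0) * L)"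
    using has_mean_cmult[OF assms(2)[of h], of c] by (auto simp: mult.assoc split: if_splits)
  ultimately show ?case by blast
next
  case (add p q)
  then obtain I I' where "(p has_integral I) {0..1}" "has_mean (\<lambda>n. p (y n) * w n) (I * L)"
    "(q has_integral I') {0..1}" "has_mean (\<lambda>n. q (y n) * w n) (I' * L)" by blast
  thus ?case using has_integral_add[of p I _ q I'] has_mean_add[of "\<lambda>n. p (y n) * w n" "I * L" "\<lambda>n. q (y n) * w n" "I' * L"]
    by (intro exI[of _ "I + I'"]) (auto simp: distrib_right)
qed

text \<open>Stone-Weierstrass on the unit circle. Composing with \<open>cis\<close> encodes
  periodicity on a compact domain, and the uniform error survives the weights since these have norm
  at most 1.\<close>

lemma circle_function_has_mean:
  fixes U :: "complex \<Rightarrow> real"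
  assumes cont: "continuous_on UNIV U" and w: "\<And>n. norm (w n) \<le> 1"
    and chars: "\<And>h :: int. has_mean (\<lambda>n. cis (2 * pi * of_int h * y n) * w n) (if h = 0 then L else 0)"
  shows "has_mean (\<lambda>n. of_real (U (cis (2 * pi * y n))) * w n)
           (of_real (integral {0..1} (\<lambda>t. U (cis (2 * pi * t)))) * L)"
proof (rule has_mean_approx[of "norm L"])
  fix e :: real assume "e > 0"
  have cU: "continuous_on {0..1} (\<lambda>t. U (cis (2 * pi * t)))"
    by (intro continuous_on_compose2[OF cont] continuous_intros) auto
  obtain P where P: "real_polynomial_function P" "\<And>z. z \<in> sphere 0 1 \<Longrightarrow> \<bar>U z - P z\<bar> < e"
    using Stone_Weierstrass_real_polynomial_function[of "sphere 0 1" U e] \<open>e > 0\<close>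
      continuous_on_subset[OF cont] by (metis compact_sphere subset_UNIV)
  have cP: "continuous_on {0..1} (\<lambda>t. P (cis (2 * pi * t)))"
    by (intro continuous_on_compose2[OF continuous_on_polymonial_function[of P UNIV]] continuous_intros)
       (use P(1) in \<open>auto simp: real_polynomial_function_eq\<close>)
  have le: "\<bar>U (cis t) - P (cis t)\<bar> \<le> e" for t
    using P(2)[of "cis t"] by simp
  obtain I where I: "((\<lambda>t. complex_of_real (P (cis (2 * pi * t)))) has_integral I) {0..1}"
      "has_mean (\<lambda>n. of_real (P (cis (2 * pi * y n))) * w n) (I * L)"
    using trig_polynomial_has_mean[OF trig_polynomial_real_polynomial_function[OF P(1)] chars] by blast
  have "((\<lambda>t. P (cis (2 * pi * t))) has_integral integral {0..1} (\<lambda>t. P (cis (2 * pi * t)))) {0..1}"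
    by (intro integrable_integral integrable_continuous_interval cP)
  from has_integral_unique[OF I(1) has_integral_of_real[OF this]]
  have I_eq: "I = of_real (integral {0..1} (\<lambda>t. P (cis (2 * pi * t))))" .
  have "integral {0..1} (\<lambda>t. U (cis (2 * pi * t))) - integral {0..1} (\<lambda>t. P (cis (2 * pi * t))) =
        integral {0..1} (\<lambda>t. U (cis (2 * pi * t)) - P (cis (2 * pi * t)))"
    by (intro integral_diff[symmetric] integrable_continuous_interval cU cP)
  moreover have "norm (integral {0..1} (\<lambda>t. U (cis (2 * pi * t)) - P (cis (2 * pi * t)))) \<le> e * (1 - 0)"
    by (intro integral_bound continuous_intros cU cP) (auto simp: le)
  ultimately have "\<bar>integral {0..1} (\<lambda>t. U (cis (2 * pi * t))) - integral {0..1} (\<lambda>t. P (cis (2 * pi * t)))\<bar> \<le> e"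
    by simp
  hence "norm (of_real (integral {0..1} (\<lambda>t. U (cis (2 * pi * t)))) * L - I * L) \<le> norm L * e"
    unfolding I_eq left_diff_distrib[symmetric] of_real_diff[symmetric] norm_mult norm_of_real
    by (subst mult.commute) (intro mult_left_mono norm_ge_zero)
  moreover have "norm ((\<Sum>n\<in>{1..N}. of_real (U (cis (2 * pi * y n))) * w n -
       of_real (P (cis (2 * pi * y n))) * w n) / of_nat N) \<le> e" for N
  proof (rule norm_mean_le)
    fix n
    have "\<bar>U (cis (2 * pi * y n)) - P (cis (2 * pi * y n))\<bar> * norm (w n) \<le> e * 1"
      by (intro mult_mono le w) (use \<open>e > 0\<close> in auto)
    thus "norm (of_real (U (cis (2 * pi * y n))) * w n - of_real (P (cis (2 * pi * y n))) * w n) \<le> e"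
      unfolding left_diff_distrib[symmetric] of_real_diff[symmetric] norm_mult norm_of_real by simp
  qed (use \<open>e > 0\<close> in simp)
  ultimately show "\<exists>z' L'. has_mean z' L' \<and>
      norm (of_real (integral {0..1} (\<lambda>t. U (cis (2 * pi * t)))) * L - L') \<le> norm L * e \<and>
      (\<forall>\<^sub>F N in sequentially. norm ((\<Sum>n\<in>{1..N}. of_real (U (cis (2 * pi * y n))) * w n - z' n) / of_nat N) \<le> e)"
    using I(2) by (intro exI conjI always_eventually allI)
qed simp

section \<open>From continuous functions to indicators of intervals\<close>

text \<open>The parameters 0 and 1 give the same point of the circle, so one of the two parameters
  is kept strictly inside.\<close>

lemma cis_2pi_inj:
  assumes "t \<in> {0<..<1}" "s \<in> {0..1}" "cis (2 * pi * s) = cis (2 * pi * t)"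
  shows "s = t"
proof -
  have "cis (2 * pi * (s - t)) = 1"
    using assms(3) by (simp add: right_diff_distrib flip: cis_divide)
  hence "cos (2 * pi * (s - t)) = 1" by (simp add: complex_eq_iff)
  then obtain k :: int where "2 * pi * (s - t) = k * 2 * pi" by (auto simp: cos_one_2pi_int)
  hence k: "s - t = k" by simp
  hence "\<bar>real_of_int k\<bar> < 1" using assms(1,2) by auto
  hence "k = 0" by linarith
  thus ?thesis using k by simp
qed

lemma cis_2pi_frac: "cis (2 * pi * frac x) = cis (2 * pi * x)"
proof -
  have "cis (2 * pi * x) = cis (2 * pi * frac x) * cis (2 * pi * of_int \<lfloor>x\<rfloor>)"
    by (simp add: frac_def algebra_simps cis_mult)
  thus ?thesis by (simp add: cis_multiple_2pi)
qed

text \<open>Off \<open>K\<close> the distance is positive and the cutoff is eventually 0. The set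
  has to be nonempty because \<open>infdist z {} = 0\<close>, which would make the cutoff constantly
  1.\<close>

lemma infdist_cutoff_tendsto:
  assumes "closed K" "K \<noteq> {}"
  shows "(\<lambda>m. max 0 (1 - real m * infdist z K)) \<longlonglongrightarrow> (if z \<in> K then 1 else 0)"
proof (cases "z \<in> K")
  case False
  hence pos: "infdist z K > 0"
    using assms in_closed_iff_infdist_zero infdist_nonneg by (metis less_eq_real_def)
  then obtain m0 :: nat where m0: "1 < real m0 * infdist z K"
    using reals_Archimedean3 by blast
  have "max 0 (1 - real m * infdist z K) = 0" if "m \<ge> m0" for m
  proof -
    have "real m0 * infdist z K \<le> real m * infdist z K"
      using that pos by (intro mult_right_mono) auto
    thus ?thesis using m0 by simp
  qed
  hence "\<forall>\<^sub>F m in sequentially. max 0 (1 - real m * infdist z K) = 0"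
    by (auto simp: eventually_sequentially)
  thus ?thesis using False by (simp add: tendsto_eventually)
qed simp

lemma integral_infdist_cutoff_tendsto:
  fixes K :: "complex set"
  assumes "closed K" "K \<noteq> {}"
    and "((\<lambda>t. if cis (2 * pi * t) \<in> K then 1 else 0 :: real) has_integral I) {0..1}"
  shows "(\<lambda>m. integral {0..1} (\<lambda>t. max 0 (1 - real m * infdist (cis (2 * pi * t)) K))) \<longlonglongrightarrow> I"
proof -
  have "(\<lambda>m. integral {0..1} (\<lambda>t. max 0 (1 - real m * infdist (cis (2 * pi * t)) K)))
      \<longlonglongrightarrow> integral {0..1} (\<lambda>t. if cis (2 * pi * t) \<in> K then 1 else 0 :: real)"
  proof (rule dominated_convergence(2)[where h = "\<lambda>_. 1"])
    fix m
    show "(\<lambda>t. max 0 (1 - real m * infdist (cis (2 * pi * t)) K)) integrable_on {0..1}"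
      by (intro integrable_continuous_interval continuous_intros continuous_on_infdist)
    fix t :: real
    show "norm (max 0 (1 - real m * infdist (cis (2 * pi * t)) K)) \<le> 1"
      by (auto simp: infdist_nonneg max_def)
  qed (use infdist_cutoff_tendsto[OF assms(1,2)] in auto)
  thus ?thesis using integral_unique[OF assms(3)] by simp
qed

text \<open>The indicator lies between two continuous functions on the circle whose gap
  \<open>W\<close> has small integral. Weighted means control only the main term. The error is
  estimated in absolute value by the mean of \<open>W\<close>, and this is where the characters
  without weight enter.\<close>

lemma interval_indicator_has_mean:
  fixes y :: "nat \<Rightarrow> real"
  assumes ab: "0 \<le> a" "a \<le> b" "b \<le> 1" and I: "{a<..<b} \<subseteq> I" "I \<subseteq> {a..b}"
    and w: "\<And>n. norm (w n) \<le> 1"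
    and unweighted: "\<And>h :: int. h \<noteq> 0 \<Longrightarrow> has_mean (\<lambda>n. cis (2 * pi * of_int h * y n)) 0"
    and chars: "\<And>h :: int. has_mean (\<lambda>n. cis (2 * pi * of_int h * y n) * w n) (if h = 0 then L else 0)"
  shows "has_mean (\<lambda>n. of_bool (frac (y n) \<in> I) * w n) (of_real (b - a) * L)"
proof (rule has_mean_approx[of "norm L"])
  fix e :: real assume "e > 0"
  define \<zeta> where "\<zeta> = (\<lambda>t::real. cis (2 * pi * t))"
  define K where "K = \<zeta> ` {a..b}"
  define K' where "K' = \<zeta> ` ({0..1} - {a<..<b})"
  define U where "U = (\<lambda>m z. max 0 (1 - real m * infdist z K))"
  define V where "V = (\<lambda>m z. max 0 (1 - real m * infdist z K'))"
  \<comment> \<open>\<open>1 - V m\<close> and \<open>U m\<close> are a continuous minorant and majorant of the indicator on the circle.\<close>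
  have comp: "compact (\<zeta> ` S)" if "compact S" for S
    unfolding \<zeta>_def by (intro compact_continuous_image continuous_intros that)
  have K: "closed K" "K \<noteq> {}" "closed K'" "K' \<noteq> {}"
  proof -
    show "closed K" unfolding K_def by (intro compact_imp_closed comp) auto
    show "closed K'" unfolding K'_def by (intro compact_imp_closed comp compact_diff) auto
    show "K \<noteq> {}" using ab by (auto simp: K_def)
    have "0 \<in> {0..1} - {a<..<b}" using ab by auto
    thus "K' \<noteq> {}" unfolding K'_def by blast
  qed
  have cont: "continuous_on S (U m)" "continuous_on S (V m)" for m S
    unfolding U_def V_def by (intro continuous_intros continuous_on_infdist)+
  have ivl: "((\<lambda>t. if t \<in> {a..b} then 1 else 0 :: real) has_integral (b - a)) {0..1}"
    using has_integral_const_real[of "1::real" a b] ab by (subst has_integral_restrict) auto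
  have intK: "((\<lambda>t. if \<zeta> t \<in> K then 1 else 0 :: real) has_integral (b - a)) {0..1}"
  \<comment> \<open>The points 0 and 1 are exceptional: if only one of them lies in
    \<open>{a..b}\<close>, both are still mapped into \<open>K\<close>.\<close>
  proof (rule has_integral_spike_finite[where S = "{0,1}"])
    show "((\<lambda>t. if t \<in> {a..b} then 1 else 0 :: real) has_integral (b - a)) {0..1}" by (rule ivl)
    fix t :: real assume t: "t \<in> {0..1} - {0,1}"
    have "\<zeta> t \<in> K \<longleftrightarrow> t \<in> {a..b}"
    proof
      assume "\<zeta> t \<in> K"
      then obtain s where "s \<in> {a..b}" "\<zeta> s = \<zeta> t" by (metis K_def imageE)
      thus "t \<in> {a..b}" using cis_2pi_inj[of t s] t ab by (auto simp: \<zeta>_def)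
    qed (auto simp: K_def)
    thus "(if \<zeta> t \<in> K then 1 else 0 :: real) = (if t \<in> {a..b} then 1 else 0)" by simp
  qed simp
  have K'_iff: "\<zeta> t \<in> K' \<longleftrightarrow> t \<notin> {a<..<b}" if t: "t \<in> {0..1}" for t
  proof
    assume "\<zeta> t \<in> K'"
    then obtain s where "s \<in> {0..1} - {a<..<b}" "\<zeta> s = \<zeta> t" by (metis (no_types, lifting) K'_def imageE)
    thus "t \<notin> {a<..<b}" using cis_2pi_inj[of t s] ab by (auto simp: \<zeta>_def)
  qed (use t in \<open>auto simp: K'_def\<close>)
  have intK': "((\<lambda>t. if \<zeta> t \<in> K' then 1 else 0 :: real) has_integral 1 - (b - a)) {0..1}"
  \<comment> \<open>Here \<open>a\<close> and \<open>b\<close> are exceptional, because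
    \<open>K'\<close> comes from the complement of the open interval.\<close>
  proof (rule has_integral_spike_finite[where S = "{a,b}"])
    show "((\<lambda>t. 1 - (if t \<in> {a..b} then 1 else 0) :: real) has_integral 1 - (b - a)) {0..1}"
      using has_integral_diff[OF has_integral_const_real[of "1::real" 0 1] ivl] by simp
    fix t :: real assume t: "t \<in> {0..1} - {a,b}"
    thus "(if \<zeta> t \<in> K' then 1 else 0 :: real) = 1 - (if t \<in> {a..b} then 1 else 0)"
      using K'_iff[of t] by auto
  qed simp
  have limU: "(\<lambda>m. integral {0..1} (\<lambda>t. U m (\<zeta> t))) \<longlonglongrightarrow> b - a"
    unfolding U_def using integral_infdist_cutoff_tendsto[OF K(1,2)] intK by (simp add: \<zeta>_def)
  have limV: "(\<lambda>m. integral {0..1} (\<lambda>t. V m (\<zeta> t))) \<longlonglongrightarrow> 1 - (b - a)"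
    unfolding V_def using integral_infdist_cutoff_tendsto[OF K(3,4)] intK' by (simp add: \<zeta>_def)
  \<comment> \<open>The two integrals add up to 1 in the limit, so their excess over 1, which is the
    integral of \<open>W\<close>, can be made smaller than \<open>e\<close>.\<close>
  have "(\<lambda>m. integral {0..1} (\<lambda>t. U m (\<zeta> t)) + integral {0..1} (\<lambda>t. V m (\<zeta> t))) \<longlonglongrightarrow> (b - a) + (1 - (b - a))"
    by (intro tendsto_add limU limV)
  hence "\<forall>\<^sub>F m in sequentially. integral {0..1} (\<lambda>t. U m (\<zeta> t)) + integral {0..1} (\<lambda>t. V m (\<zeta> t)) < 1 + e"
    using \<open>e > 0\<close> by (intro order_tendstoD(2)[of _ "(b - a) + (1 - (b - a))"]) auto
  moreover have "\<forall>\<^sub>F m in sequentially. dist (integral {0..1} (\<lambda>t. U m (\<zeta> t))) (b - a) < e"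
    using limU \<open>e > 0\<close> by (rule tendstoD)
  ultimately have "\<forall>\<^sub>F m in sequentially.
      integral {0..1} (\<lambda>t. U m (\<zeta> t)) + integral {0..1} (\<lambda>t. V m (\<zeta> t)) < 1 + e \<and>
      dist (integral {0..1} (\<lambda>t. U m (\<zeta> t))) (b - a) < e" by eventually_elim auto
  then obtain m where m: "integral {0..1} (\<lambda>t. U m (\<zeta> t)) + integral {0..1} (\<lambda>t. V m (\<zeta> t)) < 1 + e"
      "dist (integral {0..1} (\<lambda>t. U m (\<zeta> t))) (b - a) < e"
    by (auto simp: eventually_sequentially)
  define W where "W = (\<lambda>z. U m z + V m z - 1)"
  have "has_mean (\<lambda>n. of_real (W (cis (2 * pi * y n))) * 1)
          (of_real (integral {0..1} (\<lambda>t. W (cis (2 * pi * t)))) * 1)"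
  proof (rule circle_function_has_mean)
    show "continuous_on UNIV W" unfolding W_def by (intro continuous_intros cont)
    show "has_mean (\<lambda>n. cis (2 * pi * of_int h * y n) * 1) (if h = 0 then 1 else 0)" for h
      using has_mean_one unweighted[of h] by auto
  qed simp
  hence meanW: "(\<lambda>N. (\<Sum>n\<in>{1..N}. W (\<zeta> (y n))) / real N) \<longlonglongrightarrow> integral {0..1} (\<lambda>t. W (\<zeta> t))"
    unfolding has_mean_def 
    by (subst tendsto_of_real_iff[where 'a = complex, symmetric]) (simp add: \<zeta>_def)
  have integ: "(\<lambda>t. U m (\<zeta> t)) integrable_on {0..1}" "(\<lambda>t. V m (\<zeta> t)) integrable_on {0..1}"
    unfolding \<zeta>_def
    by (intro integrable_continuous_interval continuous_on_compose2[OF cont(1)[of UNIV]]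
          continuous_on_compose2[OF cont(2)[of UNIV]] continuous_intros subset_UNIV)+
  have "((\<lambda>t. W (\<zeta> t)) has_integral
      integral {0..1} (\<lambda>t. U m (\<zeta> t)) + integral {0..1} (\<lambda>t. V m (\<zeta> t)) - 1) {0..1}"
    unfolding W_def using has_integral_const_real[of "1::real" 0 1]
    by (intro has_integral_diff has_integral_add integrable_integral integ) simp
  hence "integral {0..1} (\<lambda>t. W (\<zeta> t)) < e" using m(1) by (simp add: integral_unique)
  hence small: "\<forall>\<^sub>F N in sequentially. (\<Sum>n\<in>{1..N}. W (\<zeta> (y n))) / real N < e"
    by (rule order_tendstoD(2)[OF meanW])
  \<comment> \<open>Where the indicator is 1, \<open>U m\<close> is 1 and \<open>W\<close> equals
    \<open>V m\<close>; where it is 0, \<open>V m\<close> is 1 and \<open>W\<close> equals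
    \<open>U m\<close>.\<close>
  have ptwise: "\<bar>of_bool (frac u \<in> I) - U m (\<zeta> u)\<bar> \<le> W (\<zeta> u)" for u
  proof -
    define t where "t = frac u"
    have t: "t \<in> {0..1}" "\<zeta> u = \<zeta> t"
      using frac_ge_0[of u] frac_lt_1[of u] by (auto simp: t_def \<zeta>_def cis_2pi_frac)
    have range: "0 \<le> U m z" "U m z \<le> 1" "0 \<le> V m z" for z
      by (auto simp: U_def V_def infdist_nonneg)
    show ?thesis
    proof (cases "t \<in> I")
      case True
      hence "\<zeta> t \<in> K" using I ab by (auto simp: K_def)
      hence "U m (\<zeta> t) = 1" by (simp add: U_def)
      thus ?thesis using range[of "\<zeta> t"] True t by (simp add: W_def flip: t_def)
    next
      case False
      hence "\<zeta> t \<in> K'" using I t by (auto simp: K'_def)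
      hence "V m (\<zeta> t) = 1" by (simp add: V_def)
      thus ?thesis using range[of "\<zeta> t"] False t by (simp add: W_def flip: t_def)
    qed
  qed
  have "has_mean (\<lambda>n. of_real (U m (cis (2 * pi * y n))) * w n)
          (of_real (integral {0..1} (\<lambda>t. U m (cis (2 * pi * t)))) * L)"
    by (intro circle_function_has_mean cont w chars)
  hence "has_mean (\<lambda>n. of_real (U m (\<zeta> (y n))) * w n) (of_real (integral {0..1} (\<lambda>t. U m (\<zeta> t))) * L)"
    by (simp add: \<zeta>_def)
  moreover have "norm (of_real (b - a) * L - of_real (integral {0..1} (\<lambda>t. U m (\<zeta> t))) * L) \<le> norm L * e"
    using m(2) unfolding left_diff_distrib[symmetric] of_real_diff[symmetric] norm_mult norm_of_real
    by (subst mult.commute) (auto simp: dist_real_def intro!: mult_left_mono)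
  moreover have "\<forall>\<^sub>F N in sequentially. norm ((\<Sum>n\<in>{1..N}. of_bool (frac (y n) \<in> I) * w n -
      of_real (U m (\<zeta> (y n))) * w n) / of_nat N) \<le> e"
    using small
  proof eventually_elim
    case (elim N)
    have "norm (\<Sum>n\<in>{1..N}. of_bool (frac (y n) \<in> I) * w n - of_real (U m (\<zeta> (y n))) * w n) \<le>
        (\<Sum>n\<in>{1..N}. W (\<zeta> (y n)))"
    proof (rule sum_norm_le)
      fix n
      have real: "of_bool (frac (y n) \<in> I) - complex_of_real (U m (\<zeta> (y n))) =
          of_real (of_bool (frac (y n) \<in> I) - U m (\<zeta> (y n)))" by simp
      have "norm (of_bool (frac (y n) \<in> I) * w n - of_real (U m (\<zeta> (y n))) * w n) =
          \<bar>of_bool (frac (y n) \<in> I) - U m (\<zeta> (y n))\<bar> * norm (w n)"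
        unfolding left_diff_distrib[symmetric] norm_mult real norm_of_real ..
      also have "\<dots> \<le> W (\<zeta> (y n)) * 1"
        using ptwise[of "y n"] by (intro mult_mono w) auto
      finally show "norm (of_bool (frac (y n) \<in> I) * w n - of_real (U m (\<zeta> (y n))) * w n) \<le> W (\<zeta> (y n))"
        by simp
    qed
    hence "norm ((\<Sum>n\<in>{1..N}. of_bool (frac (y n) \<in> I) * w n - of_real (U m (\<zeta> (y n))) * w n) / of_nat N)
        \<le> (\<Sum>n\<in>{1..N}. W (\<zeta> (y n))) / real N"
      by (simp add: norm_divide divide_right_mono)
    thus ?case using elim by linarith
  qed
  ultimately show "\<exists>z' L'. has_mean z' L' \<and> norm (of_real (b - a) * L - L') \<le> norm L * e \<and>
      (\<forall>\<^sub>F N in sequentially. norm ((\<Sum>n\<in>{1..N}. of_bool (frac (y n) \<in> I) * w n - z' n) / of_nat N) \<le> e)"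
    by (intro exI conjI)
qed simp

lemma interval_endpoints:
  fixes I :: "real set"
  assumes "is_interval I" "I \<subseteq> {0..1}" "I \<noteq> {}"
  obtains a b where "0 \<le> a" "a \<le> b" "b \<le> 1" "{a<..<b} \<subseteq> I" "I \<subseteq> {a..b}"
proof
  have bdd: "bdd_below I" "bdd_above I"
    using assms(2) by (meson bdd_below_Icc bdd_below_mono, meson bdd_above_Icc bdd_above_mono)
  show I: "I \<subseteq> {Inf I..Sup I}"
    using bdd by (auto intro: cInf_lower cSup_upper)
  show "0 \<le> Inf I" "Sup I \<le> 1"
    using assms(2,3) by (auto intro!: cInf_greatest cSup_least)
  show "Inf I \<le> Sup I" using I assms(3) by auto
  show "{Inf I<..<Sup I} \<subseteq> I"
  proof
    fix t assume t: "t \<in> {Inf I<..<Sup I}"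
    obtain u where "u \<in> I" "u < t" using cInf_less_iff[OF assms(3) bdd(1)] t by auto
    moreover obtain v where "v \<in> I" "t < v" using less_cSup_iff[OF assms(3) bdd(2)] t by auto
    ultimately show "t \<in> I"
      using assms(1) unfolding is_interval_1 by (meson less_eq_real_def)
  qed
qed

section \<open>Boxes and several coordinates\<close>

text \<open>The set lies between the open and the closed box, which differ by a negligible
  frontier.\<close>

lemma measure_lebesgue_box_of_intervals:
  fixes I :: "'k::finite \<Rightarrow> real set"
  assumes ab: "\<And>i. a i \<le> b i" and I: "\<And>i. {a i<..<b i} \<subseteq> I i" "\<And>i. I i \<subseteq> {a i..b i}"
  shows "measure lebesgue {y :: real ^ 'k. \<forall>i. y $ i \<in> I i} = (\<Prod>i\<in>UNIV. b i - a i)"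
proof -
  define A B :: "real ^ 'k" where "A = (\<chi> i. a i)" and "B = (\<chi> i. b i)"
  let ?S = "{y :: real ^ 'k. \<forall>i. y $ i \<in> I i}"
  have sub: "box A B \<subseteq> ?S" "?S \<subseteq> cbox A B"
  proof -
    show "box A B \<subseteq> ?S"
      using I(1) by (auto simp: A_def B_def mem_box_cart intro!: subsetD[OF I(1)])
    show "?S \<subseteq> cbox A B"
    proof
      fix y assume "y \<in> ?S"
      hence "y $ i \<in> {a i..b i}" for i using I(2)[of i] by auto
      thus "y \<in> cbox A B" by (simp add: A_def B_def mem_box_cart)
    qed
  qed
  have "negligible (cbox A B - ?S)" "negligible (?S - cbox A B)"
    using sub negligible_frontier_interval[of A B] negligible_subset by (blast, simp)
  hence "measure lebesgue ?S = measure lebesgue (cbox A B)"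
    by (intro measure_negligible_symdiff) auto
  also have "\<dots> = (\<Prod>i\<in>UNIV. b i - a i)"
  proof -
    have "A \<in> cbox A B" using ab by (simp add: A_def B_def mem_box_cart)
    hence "cbox A B \<noteq> {}" by blast
    thus ?thesis by (subst measure_completion) (simp_all add: content_cbox_cart, simp add: A_def B_def)
  qed
  finally show ?thesis .
qed

text \<open>Approximation takes place on the circle only: each coordinate is handled by the
  one-dimensional result, with the product of the remaining factors as weight.\<close>

lemma weyl_criterion:
  fixes x :: "nat \<Rightarrow> real ^ 'k"
  assumes chars: "\<And>h :: 'k \<Rightarrow> int. h \<noteq> (\<lambda>_. 0) \<Longrightarrow>
    has_mean (\<lambda>n. cis (2 * pi * (\<Sum>i\<in>UNIV. of_int (h i) * x n $ i))) 0"
  shows "uniformly_distributed_mod1 x"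
  unfolding uniformly_distributed_mod1_def
proof (intro allI impI)
  fix I :: "'k \<Rightarrow> real set"
  assume I: "\<forall>i. is_interval (I i) \<and> I i \<subseteq> {0..1}"
  show "(\<lambda>N. real (card {n \<in> {1..N}. \<forall>i. frac (x n $ i) \<in> I i}) / real N)
          \<longlonglongrightarrow> measure lebesgue {y :: real ^ 'k. \<forall>i. y $ i \<in> I i}"
  \<comment> \<open>An empty factor has no endpoints to work with; in that case counts and measure
    are all 0.\<close>
  proof (cases "\<exists>i. I i = {}")
    case True
    hence "{n \<in> {1..N}. \<forall>i. frac (x n $ i) \<in> I i} = {}" "{y :: real ^ 'k. \<forall>i. y $ i \<in> I i} = {}" for N
      by blast+
    thus ?thesis by (simp only: card.empty measure_empty) simp
  next
    case False
    have "\<exists>a b. 0 \<le> a \<and> a \<le> b \<and> b \<le> 1 \<and> {a<..<b} \<subseteq> I i \<and> I i \<subseteq> {a..b}" for i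
      using interval_endpoints[of "I i"] I False by metis
    then obtain a b where ab: "\<And>i. 0 \<le> a i" "\<And>i. a i \<le> b i" "\<And>i. b i \<le> 1"
      "\<And>i. {a i<..<b i} \<subseteq> I i" "\<And>i. I i \<subseteq> {a i..b i}" by metis
    \<comment> \<open>The coordinates are switched one at a time from characters to interval indicators.\<close>
    have mixed: "has_mean (\<lambda>n. (\<Prod>i\<in>A. of_bool (frac (x n $ i) \<in> I i)) *
            cis (2 * pi * (\<Sum>i\<in>-A. of_int (h i) * x n $ i)))
          (if \<forall>i\<in>-A. h i = 0 then of_real (\<Prod>i\<in>A. b i - a i) else 0)" for A and h :: "'k \<Rightarrow> int"
    proof (induction A arbitrary: h rule: finite_induct[OF finite])
      case 1
      show ?case
      proof (cases "h = (\<lambda>_. 0)")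
        case True
        thus ?thesis using has_mean_one by simp
      next
        case False
        thus ?thesis using chars[OF False] by (auto simp: fun_eq_iff)
      qed
    next
      case (2 j A)
      let ?w = "\<lambda>n. (\<Prod>i\<in>A. of_bool (frac (x n $ i) \<in> I i)) *
            cis (2 * pi * (\<Sum>i\<in>-insert j A. of_int (h i) * x n $ i))"
      let ?L = "if \<forall>i\<in>-insert j A. h i = 0 then of_real (\<Prod>i\<in>A. b i - a i) else (0 :: complex)"
      have "has_mean (\<lambda>n. of_bool (frac (x n $ j) \<in> I j) * ?w n) (of_real (b j - a j) * ?L)"
      proof (rule interval_indicator_has_mean)
        show "norm (?w n) \<le> 1" for n
          by (simp add: norm_mult flip: prod_norm) (intro prod_le_1, auto)
        \<comment> \<open>The vector whose only nonzero entry is \<open>m\<close> at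
          \<open>j\<close> isolates this coordinate.\<close>
        show "has_mean (\<lambda>n. cis (2 * pi * of_int m * x n $ j)) 0" if "m \<noteq> 0" for m
        proof -
          have "(\<Sum>i\<in>UNIV. of_int (((\<lambda>_. 0)(j := m)) i) * x n $ i) = of_int m * x n $ j" for n
            by (subst sum.remove[of _ j]) auto
          thus ?thesis
            using chars[of "(\<lambda>_. 0)(j := m)"] that by (simp add: fun_eq_iff mult.assoc split: if_splits)
        qed
        \<comment> \<open>The character in coordinate \<open>j\<close> is merged with the others
          through \<open>h(j := m)\<close>, which is why the induction varies
          \<open>h\<close>.\<close>
        show "has_mean (\<lambda>n. cis (2 * pi * of_int m * x n $ j) * ?w n) (if m = 0 then ?L else 0)" for m
        proof -
          have compl: "- A = insert j (- insert j A)" "j \<notin> - insert j A" using 2 by auto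
          have sum: "(\<Sum>i\<in>-A. of_int ((h(j := m)) i) * x n $ i) =
              of_int m * x n $ j + (\<Sum>i\<in>-insert j A. of_int (h i) * x n $ i)" for n
            unfolding compl(1) by (subst sum.insert) (auto intro!: sum.cong)
          have "cis (2 * pi * of_int m * x n $ j) * ?w n = (\<Prod>i\<in>A. of_bool (frac (x n $ i) \<in> I i)) *
              cis (2 * pi * (\<Sum>i\<in>-A. of_int ((h(j := m)) i) * x n $ i))" for n
            unfolding sum distrib_left by (simp add: mult.assoc mult.left_commute flip: cis_mult)
          moreover have "(if m = 0 then ?L else 0) =
              (if \<forall>i\<in>-A. (h(j := m)) i = 0 then of_real (\<Prod>i\<in>A. b i - a i) else 0)"
            unfolding compl(1) by auto
          ultimately show ?thesis using 2(3)[of "h(j := m)"] by presburger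
        qed
      qed (use ab in auto)
      moreover have "of_real (b j - a j) * ?L =
          (if \<forall>i\<in>-insert j A. h i = 0 then of_real (\<Prod>i\<in>insert j A. b i - a i) else 0)"
        using 2 by simp
      ultimately show ?case using 2 by (simp add: mult.assoc)
    qed
    have hit: "(\<Prod>i\<in>UNIV. of_bool (frac (x n $ i) \<in> I i)) = (of_bool (\<forall>i. frac (x n $ i) \<in> I i) :: complex)" for n
      by (auto simp: prod_zero_iff)
    have "(\<Sum>n\<in>{1..N}. of_bool (\<forall>i. frac (x n $ i) \<in> I i)) =
        complex_of_real (real (card {n \<in> {1..N}. \<forall>i. frac (x n $ i) \<in> I i}))" for N
      by (subst sum_of_bool_eq) (auto simp: Int_def)
    hence "(\<lambda>N. complex_of_real (real (card {n \<in> {1..N}. \<forall>i. frac (x n $ i) \<in> I i}) / real N)) \<longlonglongrightarrow>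
        complex_of_real (\<Prod>i\<in>UNIV. b i - a i)"
      using mixed[of UNIV "\<lambda>_. 0"] hit by (simp add: has_mean_def)
    hence "(\<lambda>N. real (card {n \<in> {1..N}. \<forall>i. frac (x n $ i) \<in> I i}) / real N) \<longlonglongrightarrow>
        (\<Prod>i\<in>UNIV. b i - a i)"
      by (simp only: tendsto_of_real_iff)
    thus ?thesis using measure_lebesgue_box_of_intervals[of a b I] ab by simp
  qed
qed

section \<open>Almost everywhere convergence of exponential averages\<close>

text \<open>For \<open>M j \<le> N < M (Suc j)\<close> the sums up to \<open>N\<close> and up to
  \<open>M j\<close> differ by at most \<open>M (Suc j) - M j\<close> terms of modulus at most 1,
  which the ratio hypothesis makes small compared with \<open>M j\<close>.\<close>

lemma has_mean_zero_subsequence: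
  fixes M :: "nat \<Rightarrow> nat"
  assumes z: "\<And>n. norm (z n) \<le> 1" and "mono M" and top: "filterlim M at_top sequentially"
    and ratio: "(\<lambda>j. real (M (Suc j)) / real (M j)) \<longlonglongrightarrow> 1"
    and sub: "(\<lambda>j. norm (\<Sum>n\<in>{1..M j}. z n) / real (M j)) \<longlonglongrightarrow> 0"
  shows "has_mean z 0"
  unfolding has_mean_def
proof (rule tendstoI)
  fix e :: real assume "e > 0"
  define S where "S = (\<lambda>N. \<Sum>n\<in>{1..N}. z n)"
  have "\<forall>\<^sub>F j in sequentially. norm (S (M j)) / real (M j) < e / 2"
    using sub \<open>e > 0\<close> unfolding S_def by (intro order_tendstoD(2)) auto
  moreover have "\<forall>\<^sub>F j in sequentially. real (M (Suc j)) / real (M j) < 1 + e / 2"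
    using ratio \<open>e > 0\<close> by (intro order_tendstoD(2)) auto
  moreover have "\<forall>\<^sub>F j in sequentially. 1 \<le> M j"
    using top by (simp add: filterlim_at_top)
  ultimately have "\<forall>\<^sub>F j in sequentially. norm (S (M j)) / real (M j) < e / 2 \<and>
      real (M (Suc j)) / real (M j) < 1 + e / 2 \<and> 1 \<le> M j" by eventually_elim auto
  then obtain J where J: "\<And>j. j \<ge> J \<Longrightarrow> norm (S (M j)) / real (M j) < e / 2"
      "\<And>j. j \<ge> J \<Longrightarrow> real (M (Suc j)) / real (M j) < 1 + e / 2" "\<And>j. j \<ge> J \<Longrightarrow> 1 \<le> M j"
    by (auto simp: eventually_sequentially)
  have "dist (S N / of_nat N) 0 < e" if N: "N \<ge> M J" for N
  proof -
    have "\<exists>l. N < M l"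
      using top unfolding filterlim_at_top eventually_sequentially
      by (metis Suc_le_lessD le_refl)
    \<comment> \<open>The least index whose value exceeds \<open>N\<close>; its predecessor
      \<open>j\<close> locates \<open>N\<close> between consecutive terms of
      \<open>M\<close>.\<close>
    define l where "l = (LEAST l. N < M l)"
    have l: "N < M l" unfolding l_def using \<open>\<exists>l. N < M l\<close> by (rule LeastI_ex)
    have "J < l"
      using l N monoD[OF \<open>mono M\<close>, of l J] by (metis leI leD order_trans)
    then obtain j where j: "l = Suc j" "J \<le> j" by (cases l) auto
    have Mj: "M j \<le> N" using not_less_Least[of j "\<lambda>l. N < M l"] j by (auto simp: l_def)
    have pos: "0 < real (M j)" using J(3)[OF j(2)] by simp
    have "{1..N} = {1..M j} \<union> {M j<..N}" using Mj by auto
    hence "S N = S (M j) + (\<Sum>n\<in>{M j<..N}. z n)"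
      unfolding S_def by (simp only:) (rule sum.union_disjoint; auto)
    moreover have "norm (\<Sum>n\<in>{M j<..N}. z n) \<le> real (card {M j<..N}) * 1"
      by (rule sum_norm_bound) (rule z)
    ultimately have "norm (S N) \<le> norm (S (M j)) + (real N - real (M j))"
      using norm_triangle_ineq[of "S (M j)" "\<Sum>n\<in>{M j<..N}. z n"] Mj by (simp add: of_nat_diff)
    also have "\<dots> \<le> norm (S (M j)) + (real (M (Suc j)) - real (M j))"
      using l j by simp
    also have "\<dots> < e * real (M j)"
    proof -
      have "norm (S (M j)) < e / 2 * real (M j)" "real (M (Suc j)) < (1 + e / 2) * real (M j)"
        using J(1,2)[OF j(2)] pos by (simp_all add: pos_divide_less_eq)
      thus ?thesis by (simp add: algebra_simps)
    qed
    also have "\<dots> \<le> e * real N" using Mj \<open>e > 0\<close> by simp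
    finally show ?thesis using pos Mj by (simp add: norm_divide divide_simps)
  qed
  thus "\<forall>\<^sub>F N in sequentially. dist ((\<Sum>n\<in>{1..N}. z n) / of_nat N) 0 < e"
    unfolding S_def eventually_sequentially by blast
qed

section \<open>Mean squares and the subsequence argument\<close>

text \<open>The expanded square is folded onto pairs \<open>m < n\<close> to match the double sum in
  \<open>delta_scattered\<close>.\<close>

lemma norm_sum_cis_squared:
  "(norm (\<Sum>n\<in>{1..N}. cis (a n)))\<^sup>2 = real N + 2 * (\<Sum>n\<in>{1..N}. \<Sum>m\<in>{1..<n}. cos (a n - a m))"
proof (induction N)
  case (Suc N)
  let ?S = "\<Sum>n\<in>{1..N}. cis (a n)"
  have eq: "(\<Sum>n\<in>{1..Suc N}. cis (a n)) = ?S + cis (a (Suc N))" by simp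
  have "(norm (?S + cis (a (Suc N))))\<^sup>2 = (norm ?S)\<^sup>2 + 1 + 2 * (?S \<bullet> cis (a (Suc N)))"
    by (simp add: power2_norm_eq_inner inner_add_left inner_add_right inner_commute) (simp add: inner_complex_def flip: power2_eq_square)
  also have "?S \<bullet> cis (a (Suc N)) = (\<Sum>m\<in>{1..<Suc N}. cos (a (Suc N) - a m))"
    unfolding inner_sum_left atLeastLessThanSuc_atLeastAtMost
    by (intro sum.cong) (auto simp: inner_complex_def cos_diff mult.commute)
  finally show ?case unfolding eq Suc.IH by simp
qed simp

text \<open>By monotone convergence the series of the \<open>g j\<close> has finite integral over
  the interval. It therefore converges almost everywhere there, and its terms tend to 0.\<close>

lemma ae_tendsto_zero_of_summable_integrals:
  fixes g :: "nat \<Rightarrow> real \<Rightarrow> real"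
  assumes cont: "\<And>j. continuous_on {p..q} (g j)" and nonneg: "\<And>j x. 0 \<le> g j x"
    and sum: "summable (\<lambda>j. integral {p..q} (g j))"
  shows "negligible {x \<in> {p..q}. \<not> (\<lambda>j. g j x) \<longlonglongrightarrow> 0}"
proof -
  define G where "G = (\<lambda>j x. ennreal (indicator {p..q} x * g j x))"
  have hi: "(g j has_integral integral {p..q} (g j)) {p..q}" for j
    by (intro integrable_integral integrable_continuous_interval cont)
  have [measurable]: "G j \<in> borel_measurable lborel" for j
  proof -
    have "(\<lambda>x. indicator {p..q} x *\<^sub>R g j x) \<in> borel_measurable borel"
      by (intro borel_measurable_continuous_on_indicator cont) auto
    thus ?thesis by (simp add: G_def)
  qed
  have Gint: "(\<integral>\<^sup>+x. G j x \<partial>lborel) = ennreal (integral {p..q} (g j))" for j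
    unfolding G_def by (rule nn_integral_has_integral_lebesgue[OF nonneg hi])
  have "(\<integral>\<^sup>+x. (\<Sum>j. G j x) \<partial>lborel) = (\<Sum>j. ennreal (integral {p..q} (g j)))"
    by (subst nn_integral_suminf) (auto simp: Gint)
  also have "\<dots> = ennreal (\<Sum>j. integral {p..q} (g j))"
    by (intro suminf_ennreal2 sum Henstock_Kurzweil_Integration.integral_nonneg integrable_continuous_interval cont nonneg)
  finally have "(\<integral>\<^sup>+x. (\<Sum>j. G j x) \<partial>lborel) \<noteq> \<infinity>" by simp
  hence "AE x in lborel. (\<Sum>j. G j x) \<noteq> \<infinity>"
    by (intro nn_integral_PInf_AE) auto
  hence "AE x in lborel. x \<in> {p..q} \<longrightarrow> (\<lambda>j. g j x) \<longlonglongrightarrow> 0"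
  proof eventually_elim
    case (elim x)
    show ?case
    proof
      assume x: "x \<in> {p..q}"
      hence "(\<Sum>j. ennreal (g j x)) \<noteq> top" using elim by (simp add: G_def)
      hence "summable (\<lambda>j. g j x)" by (intro summable_suminf_not_top nonneg)
      thus "(\<lambda>j. g j x) \<longlonglongrightarrow> 0" by (rule summable_LIMSEQ_zero)
    qed
  qed
  hence "AE x in lebesgue. x \<in> {p..q} \<longrightarrow> (\<lambda>j. g j x) \<longlonglongrightarrow> 0"
    by (rule AE_completion)
  thus ?thesis
    by (simp add: completion.AE_iff_null_sets negligible_iff_null_sets Int_def[symmetric])
qed

text \<open>The diagonal of the square contributes \<open>real N\<close>, and each cosine integral
  is the real part of an oscillatory integral.\<close>

lemma mean_square_integral_bound:
  fixes \<phi> :: "nat \<Rightarrow> real \<Rightarrow> real"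
  assumes cont: "\<And>n. continuous_on {p..q} (\<phi> n)" and "p \<le> q"
    and osc: "\<And>m n. m < n \<Longrightarrow> norm (integral {p..q} (\<lambda>x. cis (\<phi> n x - \<phi> m x))) \<le> C * r n m"
  shows "integral {p..q} (\<lambda>x. (norm (\<Sum>n\<in>{1..N}. cis (\<phi> n x)))\<^sup>2) \<le>
           (q - p) * real N + 2 * C * (\<Sum>n\<in>{1..N}. \<Sum>m\<in>{1..<n}. r n m)"
proof -
  have cc: "continuous_on {p..q} (\<lambda>x. cos (\<phi> n x - \<phi> m x))" for n m
    by (intro continuous_intros cont)
  have int: "(\<lambda>x. cos (\<phi> n x - \<phi> m x)) integrable_on {p..q}" for n m
    by (intro integrable_continuous_interval cc)
  have le: "integral {p..q} (\<lambda>x. cos (\<phi> n x - \<phi> m x)) \<le> C * r n m" if "m < n" for n m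
  proof -
    have "(\<lambda>x. cis (\<phi> n x - \<phi> m x)) integrable_on {p..q}"
      by (intro integrable_continuous_interval continuous_intros cont)
    from integral_linear[OF this bounded_linear_Re]
    have "integral {p..q} (\<lambda>x. cos (\<phi> n x - \<phi> m x)) = Re (integral {p..q} (\<lambda>x. cis (\<phi> n x - \<phi> m x)))"
      by (simp add: o_def)
    also have "\<dots> \<le> C * r n m" using complex_Re_le_cmod osc[OF that] by (rule order_trans)
    finally show ?thesis .
  qed
  have "((\<lambda>x. real N + 2 * (\<Sum>n\<in>{1..N}. \<Sum>m\<in>{1..<n}. cos (\<phi> n x - \<phi> m x))) has_integral
      (q - p) * real N + 2 * (\<Sum>n\<in>{1..N}. \<Sum>m\<in>{1..<n}. integral {p..q} (\<lambda>x. cos (\<phi> n x - \<phi> m x)))) {p..q}"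
    using has_integral_const_real[of "real N" p q] \<open>p \<le> q\<close>
    by (intro has_integral_add has_integral_mult_right has_integral_sum integrable_integral int) auto
  hence "integral {p..q} (\<lambda>x. (norm (\<Sum>n\<in>{1..N}. cis (\<phi> n x)))\<^sup>2) =
      (q - p) * real N + 2 * (\<Sum>n\<in>{1..N}. \<Sum>m\<in>{1..<n}. integral {p..q} (\<lambda>x. cos (\<phi> n x - \<phi> m x)))"
    unfolding norm_sum_cis_squared by (rule integral_unique)
  also have "\<dots> \<le> (q - p) * real N + 2 * (\<Sum>n\<in>{1..N}. \<Sum>m\<in>{1..<n}. C * r n m)"
    by (intro add_left_mono mult_left_mono sum_mono le) auto
  finally show ?thesis by (simp add: sum_distrib_left mult.assoc)
qed

text \<open>\<open>r n m\<close> stands for the summand of \<open>delta_scattered\<close>;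
  \<open>osc\<close> is what links it to the phases.\<close>

lemma ae_has_mean_zero:
  fixes \<phi> :: "nat \<Rightarrow> real \<Rightarrow> real"
  assumes cont: "\<And>n. continuous_on {p..q} (\<phi> n)" and "p \<le> q" and "0 \<le> C"
    and osc: "\<And>m n. m < n \<Longrightarrow> norm (integral {p..q} (\<lambda>x. cis (\<phi> n x - \<phi> m x))) \<le> C * r n m"
    and "0 < \<epsilon>" and scat: "\<forall>\<^sub>F N in sequentially.
      1 / (real N)\<^sup>2 * (\<Sum>n\<in>{1..N}. \<Sum>m\<in>{1..<n}. r n m) \<le> 1 / (ln (real N)) powr (1 + \<epsilon>)"
  shows "negligible {x \<in> {p..q}. \<not> has_mean (\<lambda>n. cis (\<phi> n x)) 0}"
proof -
  define F where "F = (\<lambda>N x. (norm (\<Sum>n\<in>{1..N}. cis (\<phi> n x)) / real N)\<^sup>2)"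
  define D where "D = (q - p) + 2 * C"
  \<comment> \<open>This absorbs the diagonal contribution, of order \<open>1 / real N\<close>, into
    the logarithmic bound.\<close>
  have "((\<lambda>N. ln (real N) powr (1 + \<epsilon>) / real N) \<longlongrightarrow> 0) sequentially"
    using \<open>0 < \<epsilon>\<close> by real_asymp
  hence "\<forall>\<^sub>F N in sequentially. ln (real N) powr (1 + \<epsilon>) / real N < 1"
    by (rule order_tendstoD(2)) simp
  with scat eventually_gt_at_top[of 1]
  have bound: "\<forall>\<^sub>F N in sequentially. integral {p..q} (F N) \<le> D * ln (real N) powr (-(1 + \<epsilon>))"
  proof eventually_elim
    case (elim N)
    have "ln (real N) > 0" using elim by simp
    hence inv: "1 / real N \<le> ln (real N) powr (-(1 + \<epsilon>))"
    proof -
      have "ln (real N) powr (1 + \<epsilon>) \<le> real N" using elim by (simp add: divide_simps)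
      moreover have "0 < ln (real N) powr (1 + \<epsilon>)" using \<open>ln (real N) > 0\<close> by simp
      ultimately show ?thesis using elim(2) unfolding powr_minus_divide by (intro divide_left_mono mult_pos_pos) auto
    qed
    have scatN: "1 / (real N)\<^sup>2 * (\<Sum>n\<in>{1..N}. \<Sum>m\<in>{1..<n}. r n m) \<le>
        ln (real N) powr (-(1 + \<epsilon>))"
      using elim(1) unfolding powr_minus_divide .
    have "integral {p..q} (F N) =
        1 / (real N)\<^sup>2 * integral {p..q} (\<lambda>x. (norm (\<Sum>n\<in>{1..N}. cis (\<phi> n x)))\<^sup>2)"
      unfolding F_def power_divide by (simp flip: integral_mult_right)
    also have "\<dots> \<le> 1 / (real N)\<^sup>2 * ((q - p) * real N + 2 * C * (\<Sum>n\<in>{1..N}. \<Sum>m\<in>{1..<n}. r n m))"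
      by (intro mult_left_mono mean_square_integral_bound cont osc \<open>p \<le> q\<close>) auto
    also have "\<dots> = (q - p) * (1 / real N) +
        2 * C * (1 / (real N)\<^sup>2 * (\<Sum>n\<in>{1..N}. \<Sum>m\<in>{1..<n}. r n m))"
      using elim by (simp add: distrib_left power2_eq_square)
    also have "\<dots> \<le> (q - p) * ln (real N) powr (-(1 + \<epsilon>)) + 2 * C * ln (real N) powr (-(1 + \<epsilon>))"
      using inv scatN \<open>p \<le> q\<close> \<open>0 \<le> C\<close> by (intro add_mono mult_left_mono) auto
    finally show ?case by (simp add: D_def distrib_right)
  qed
  \<comment> \<open>The bound is summable along the subsequence since \<open>\<alpha> * (1 + \<epsilon>) > 1\<close>, and consecutive
    terms of the subsequence have ratio tending to 1 since \<open>\<alpha> < 1\<close>.\<close>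
  define \<alpha> where "\<alpha> = 1 / (1 + \<epsilon> / 2)"
  have \<alpha>: "0 < \<alpha>" "\<alpha> < 1" "\<alpha> * (1 + \<epsilon>) > 1"
    using \<open>0 < \<epsilon>\<close> by (auto simp: \<alpha>_def field_simps)
  \<comment> \<open>Rounding up changes the exponential by at most 1, too little to affect the limit
    of the ratios.\<close>
  define M where "M = (\<lambda>j. nat \<lceil>exp (real j powr \<alpha>)\<rceil>)"
  have M_ge: "exp (real j powr \<alpha>) \<le> real (M j)" for j
    unfolding M_def using of_nat_ceiling by blast
  have M_le: "real (M j) \<le> exp (real j powr \<alpha>) + 1" for j
  proof -
    have "real (M j) = of_int \<lceil>exp (real j powr \<alpha>)\<rceil>"
      unfolding M_def by (simp add: order_less_imp_le[OF exp_gt_zero])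
    thus ?thesis by linarith
  qed
  have M_pos: "0 < real (M j)" for j using M_ge[of j] exp_gt_zero order_less_le_trans by blast
  have "mono M"
    unfolding M_def
    by (intro monoI nat_mono ceiling_mono) (use \<alpha> in \<open>simp add: powr_mono2\<close>)
  have "filterlim (\<lambda>j. real (M j)) at_top sequentially"
    by (rule filterlim_at_top_mono[OF _ always_eventually[OF allI[OF M_ge]]])
       (use \<alpha> in real_asymp)
  hence top: "filterlim M at_top sequentially"
    by (simp add: filterlim_sequentially_iff_filterlim_real)
  have ratio: "(\<lambda>j. real (M (Suc j)) / real (M j)) \<longlonglongrightarrow> 1"
  proof (rule tendsto_sandwich[where f = "\<lambda>_. 1"])
    show "(\<lambda>j. (exp (real (Suc j) powr \<alpha>) + 1) / exp (real j powr \<alpha>)) \<longlonglongrightarrow> 1"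
      using \<alpha> by real_asymp
    show "\<forall>\<^sub>F j in sequentially. real (M (Suc j)) / real (M j) \<le> (exp (real (Suc j) powr \<alpha>) + 1) / exp (real j powr \<alpha>)"
      by (intro always_eventually allI frac_le M_le M_ge) (auto simp: add_nonneg_nonneg)
    show "\<forall>\<^sub>F j in sequentially. 1 \<le> real (M (Suc j)) / real (M j)"
      using monoD[OF \<open>mono M\<close>] M_pos by (intro always_eventually allI) simp
  qed simp
  have cF: "continuous_on {p..q} (F N)" for N
    unfolding F_def by (cases "N = 0") (auto intro!: continuous_intros cont)
  have "summable (\<lambda>j. integral {p..q} (F (M j)))"
  proof (rule summable_comparison_test_ev)
    show "summable (\<lambda>j. D * real j powr (- (\<alpha> * (1 + \<epsilon>))))"
      using \<alpha>(3) by (intro summable_mult) (simp add: summable_real_powr_iff)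
    have "\<forall>\<^sub>F j in sequentially. integral {p..q} (F (M j)) \<le> D * ln (real (M j)) powr (-(1 + \<epsilon>))"
      using eventually_compose_filterlim[OF bound top] .
    thus "\<forall>\<^sub>F j in sequentially. norm (integral {p..q} (F (M j))) \<le> D * real j powr (- (\<alpha> * (1 + \<epsilon>)))"
      using eventually_gt_at_top[of 0]
    proof eventually_elim
      case (elim j)
      have ln: "real j powr \<alpha> \<le> ln (real (M j))"
        using M_ge[of j] M_pos[of j] by (simp add: ln_ge_iff)
      have "integral {p..q} (F (M j)) \<ge> 0"
        by (intro Henstock_Kurzweil_Integration.integral_nonneg integrable_continuous_interval cF)
           (simp add: F_def)
      hence "norm (integral {p..q} (F (M j))) \<le> D * ln (real (M j)) powr (-(1 + \<epsilon>))"
        using elim by simp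
      also have "\<dots> \<le> D * (real j powr \<alpha>) powr (-(1 + \<epsilon>))"
        using ln elim \<open>p \<le> q\<close> \<open>0 \<le> C\<close> \<open>0 < \<epsilon>\<close>
        by (intro mult_left_mono powr_mono2') (auto simp: D_def)
      also have "(real j powr \<alpha>) powr (-(1 + \<epsilon>)) = real j powr (- (\<alpha> * (1 + \<epsilon>)))"
        unfolding powr_powr mult_minus_right ..
      finally show ?case .
    qed
  qed
  hence "negligible {x \<in> {p..q}. \<not> (\<lambda>j. F (M j) x) \<longlonglongrightarrow> 0}"
    by (intro ae_tendsto_zero_of_summable_integrals cF) (simp_all add: F_def)
  moreover have "has_mean (\<lambda>n. cis (\<phi> n x)) 0" if "(\<lambda>j. F (M j) x) \<longlonglongrightarrow> 0" for x
  proof (rule has_mean_zero_subsequence[OF _ \<open>mono M\<close> top ratio])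
    have "(\<lambda>j. sqrt (F (M j) x)) \<longlonglongrightarrow> sqrt 0" using that by (rule tendsto_real_sqrt)
    thus "(\<lambda>j. norm (\<Sum>n\<in>{1..M j}. cis (\<phi> n x)) / real (M j)) \<longlonglongrightarrow> 0"
      by (simp add: F_def)
  qed simp
  ultimately show ?thesis
    by (elim negligible_subset) blast
qed

section \<open>The equivalence\<close>

text \<open>For a given \<open>h\<close>, scatteredness of one sequence \<open>a k\<close> with
  \<open>h k \<noteq> 0\<close> is enough, because the coefficient vector of a phase difference has
  norm at least \<open>\<bar>a k n - a k m\<bar>\<close>. The decay exponent varies with
  \<open>f\<close> and \<open>x0\<close>, so scatteredness is called upon for whichever
  \<open>\<delta>\<close> arises.\<close>

lemma ae_uniformly_distributed:
  fixes f :: "'k::finite \<Rightarrow> real \<Rightarrow> real"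
  assumes analytic: "\<And>i. real_analytic (f i)" and indep: "lin_indep_with_one f"
    and scat: "\<And>i. scattered (a i)"
  shows "AE x in lebesgue. uniformly_distributed_mod1 (\<lambda>n. \<chi> i. a i n * f i x)"
proof -
  define \<phi> where "\<phi> = (\<lambda>(h :: 'k \<Rightarrow> int) n x. 2 * pi * (\<Sum>i\<in>UNIV. of_int (h i) * (a i n * f i x)))"
  define bad where "bad = (\<lambda>h. {x. \<not> has_mean (\<lambda>n. cis (\<phi> h n x)) 0})"
  have cont: "continuous_on S (f i)" for S i
    using DERIV_isCont[OF real_analytic_has_deriv[OF analytic]]
    by (intro continuous_at_imp_continuous_on) auto
  have local: "\<exists>p q. p < x0 \<and> x0 < q \<and> (\<forall>h. h \<noteq> (\<lambda>_. 0) \<longrightarrow> negligible ({p..q} \<inter> bad h))" for x0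
  proof -
    obtain p q C \<delta> where pq: "p < x0" "x0 < q" and C: "0 \<le> C" and \<delta>: "0 < \<delta>" "\<delta> \<le> 1"
      and decay: "\<And>c :: real ^ 'k. norm c \<ge> 1 \<Longrightarrow>
         norm (integral {p..q} (\<lambda>x. cis (\<Sum>i\<in>UNIV. c $ i * f i x))) \<le> C * norm c powr (-\<delta>)"
      using oscillatory_integral_decay[OF analytic indep, of x0] by blast
    have "negligible ({p..q} \<inter> bad h)" if nonzero: "h \<noteq> (\<lambda>_. 0)" for h
    proof -
      obtain k where k: "h k \<noteq> 0" using nonzero by (auto simp: fun_eq_iff)
      define r where "r = (\<lambda>n m. if a k n = a k m then 1 else min (\<bar>a k n - a k m\<bar> powr (-\<delta>)) 1)"
      \<comment> \<open>Large enough for both cases below: \<open>q - p\<close> serves the trivial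
        bound and \<open>C\<close> the decay estimate.\<close>
      define K where "K = C + (q - p)"
      obtain \<epsilon> where \<epsilon>: "0 < \<epsilon>" "\<forall>\<^sub>F N in sequentially.
          1 / (real N)\<^sup>2 * (\<Sum>n\<in>{1..N}. \<Sum>m\<in>{1..<n}. r n m) \<le> 1 / (ln (real N)) powr (1 + \<epsilon>)"
        using scat[of k] \<delta> unfolding scattered_def delta_scattered_def r_def by blast
      have "negligible {x \<in> {p..q}. \<not> has_mean (\<lambda>n. cis (\<phi> h n x)) 0}"
      proof (rule ae_has_mean_zero[OF _ _ _ _ \<epsilon>])
        show "continuous_on {p..q} (\<phi> h n)" for n
          unfolding \<phi>_def by (intro continuous_intros cont)
        show "norm (integral {p..q} (\<lambda>x. cis (\<phi> h n x - \<phi> h m x))) \<le> K * r n m" for m n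
        proof -
          define c :: "real ^ 'k" where "c = (\<chi> i. 2 * pi * of_int (h i) * (a i n - a i m))"
          have eq: "\<phi> h n x - \<phi> h m x = (\<Sum>i\<in>UNIV. c $ i * f i x)" for x
            by (simp add: \<phi>_def c_def sum_distrib_left algebra_simps flip: sum_subtractf)
          define \<Delta> where "\<Delta> = \<bar>a k n - a k m\<bar>"
          have trivial: "norm (integral {p..q} (\<lambda>x. cis (\<phi> h n x - \<phi> h m x))) \<le> 1 * (q - p)"
            using pq unfolding \<phi>_def by (intro integral_bound continuous_intros cont) auto
          have "1 * \<Delta> \<le> (2 * pi * \<bar>of_int (h k)\<bar>) * \<Delta>"
          proof (rule mult_right_mono)
            have "1 \<le> \<bar>real_of_int (h k)\<bar>" using k by linarith
            moreover have "1 \<le> 2 * pi" using pi_gt3 by simp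
            ultimately show "1 \<le> 2 * pi * \<bar>of_int (h k)\<bar>"
              using mult_mono[of 1 "2 * pi" 1 "\<bar>real_of_int (h k)\<bar>"] by simp
          qed (simp add: \<Delta>_def)
          also have "\<dots> = \<bar>c $ k\<bar>" by (simp add: c_def \<Delta>_def abs_mult)
          also have "\<dots> \<le> norm c" by (rule component_le_norm_cart)
          finally have c: "\<Delta> \<le> norm c" by simp
          show ?thesis
          \<comment> \<open>Differences below 1, including 0, give \<open>r n m = 1\<close>, and the
            length of the interval bounds the integral. Otherwise \<open>c\<close> has norm at least
            1, as the decay estimate requires.\<close>
          proof (cases "\<Delta> < 1")
            case True
            have "1 \<le> \<Delta> powr (-\<delta>)" if "\<Delta> \<noteq> 0"
            proof -
              have "0 < \<Delta>" "\<Delta> powr \<delta> \<le> 1"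
                using that True \<delta> by (auto simp: \<Delta>_def powr_le1)
              thus ?thesis by (simp add: powr_minus_divide)
            qed
            hence "r n m = 1" by (auto simp: r_def \<Delta>_def)
            thus ?thesis using trivial C by (simp add: K_def)
          next
            case False
            have "\<Delta> powr (-\<delta>) \<le> 1" using False \<delta> powr_mono2'[of "-\<delta>" 1 \<Delta>] by simp
            hence r: "r n m = \<Delta> powr (-\<delta>)" using False by (auto simp: r_def \<Delta>_def)
            have "norm (integral {p..q} (\<lambda>x. cis (\<phi> h n x - \<phi> h m x))) \<le> C * norm c powr (-\<delta>)"
              unfolding eq using c False by (intro decay) simp
            also have "\<dots> \<le> K * \<Delta> powr (-\<delta>)"
              using c False \<delta> C pq by (intro mult_mono powr_mono2') (auto simp: K_def)
            finally show ?thesis by (simp add: r)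
          qed
        qed
      qed (use pq C in \<open>auto simp: K_def\<close>)
      moreover have "{p..q} \<inter> bad h = {x \<in> {p..q}. \<not> has_mean (\<lambda>n. cis (\<phi> h n x)) 0}"
        by (auto simp: bad_def)
      ultimately show ?thesis by simp
    qed
    thus ?thesis using pq by blast
  qed
  define B where "B = (\<Union>h\<in>-{\<lambda>_. 0}. bad h)"
  have "negligible B"
  \<comment> \<open>Interval and exponent depend on the point, but local negligibility suffices. The
    union over \<open>h\<close> is harmless, as there are countably many integer vectors.\<close>
  proof (subst locally_negligible_alt, rule ballI)
    fix x0 assume x0: "x0 \<in> B"
    obtain p q where pq: "p < x0" "x0 < q"
      and neg: "\<And>h. h \<noteq> (\<lambda>_. 0) \<Longrightarrow> negligible ({p..q} \<inter> bad h)"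
      using local[of x0] by blast
    have "negligible (\<Union>h\<in>-{\<lambda>_. 0}. {p..q} \<inter> bad h)"
      by (intro negligible_countable_Union countable_image) (use neg in auto)
    hence "negligible (B \<inter> {p<..<q})"
      by (rule negligible_subset) (auto simp: B_def)
    thus "\<exists>U. openin (top_of_set B) U \<and> x0 \<in> U \<and> negligible U"
      using x0 pq by (intro exI[of _ "B \<inter> {p<..<q}"]) (auto intro: openin_open_Int)
  qed
  hence "B \<in> null_sets lebesgue" by (simp add: negligible_iff_null_sets)
  moreover have "uniformly_distributed_mod1 (\<lambda>n. \<chi> i. a i n * f i x)" if "x \<notin> B" for x
    using that by (intro weyl_criterion) (auto simp: B_def bad_def \<phi>_def)
  ultimately show ?thesis by (intro AE_I') auto
qed

section \<open>Obstruction to uniform distribution from a linear relation\<close>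

text \<open>For \<open>m < n\<close> the gap is at least half of
  \<open>\<bar>t\<bar> * 2 ^ n\<close>, so the double sum stays below a constant, by convergence of
  the series of \<open>real n * q ^ n\<close>. Dividing by the square of \<open>N\<close> then beats
  the power of the logarithm, with 1 as the witness for \<open>\<epsilon>\<close>.\<close>

lemma scattered_geometric:
  assumes "t \<noteq> 0"
  shows "scattered (\<lambda>n. t * 2 ^ n)"
  unfolding scattered_def
proof (intro allI impI)
  fix \<delta> :: real assume \<delta>: "0 < \<delta> \<and> \<delta> \<le> 1"
  define q where "q = 2 powr (-\<delta>)"
  have q: "0 < q" "q < 1" using \<delta> by (auto simp: q_def powr_less_one)
  define A where "A = (\<bar>t\<bar> / 2) powr (-\<delta>)"
  have A: "A > 0" using assms by (simp add: A_def)
  have qpow: "(2 ^ n) powr (-\<delta>) = q ^ n" for n :: nat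
    by (simp add: q_def powr_power powr_powr mult.commute flip: powr_realpow)
  define s where "s = (\<lambda>n m. if t * 2 ^ n = t * 2 ^ m then 1
      else min (\<bar>t * 2 ^ n - t * 2 ^ m\<bar> powr (-\<delta>)) (1::real))"
  have s_le: "s n m \<le> A * q ^ n" if "m < n" for m n
  proof -
    have "(2::real) ^ Suc m \<le> 2 ^ n" using that by (intro power_increasing) auto
    hence gap: "2 ^ n / 2 \<le> (2::real) ^ n - 2 ^ m" by simp
    have "\<bar>t\<bar> / 2 * 2 ^ n \<le> \<bar>t\<bar> * (2 ^ n - 2 ^ m)"
      using mult_left_mono[OF gap, of "\<bar>t\<bar>"] by simp
    also have "\<dots> = \<bar>t * 2 ^ n - t * 2 ^ m\<bar>"
    proof -
      have "\<bar>t * 2 ^ n - t * 2 ^ m\<bar> = \<bar>t\<bar> * \<bar>2 ^ n - 2 ^ m\<bar>"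
        by (simp add: abs_mult flip: right_diff_distrib)
      moreover have "(0::real) \<le> 2 ^ n - 2 ^ m" using gap by (rule order_trans[rotated]) simp
      ultimately show ?thesis by simp
    qed
    finally have "\<bar>t * 2 ^ n - t * 2 ^ m\<bar> powr (-\<delta>) \<le> (\<bar>t\<bar> / 2 * 2 ^ n) powr (-\<delta>)"
      using assms \<delta> by (intro powr_mono2') auto
    also have "\<dots> = A * q ^ n" unfolding powr_mult A_def qpow ..
    finally show ?thesis using that assms by (auto simp: s_def)
  qed
  have sum: "summable (\<lambda>n. real n * q ^ n)"
  proof (rule summable_comparison_test_bigo)
    show "summable (\<lambda>n. norm (real n powr (-2)))"
      by (simp add: summable_real_powr_iff)
    show "(\<lambda>n. real n * q ^ n) \<in> O(\<lambda>n. real n powr (-2))"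
      using q by real_asymp
  qed
  define S where "S = A * (\<Sum>n. real n * q ^ n)"
  have total: "(\<Sum>n\<in>{1..N}. \<Sum>m\<in>{1..<n}. s n m) \<le> S" for N
  proof -
    have "(\<Sum>n\<in>{1..N}. \<Sum>m\<in>{1..<n}. s n m) \<le> (\<Sum>n\<in>{1..N}. A * (real n * q ^ n))"
    proof (rule sum_mono)
      fix n assume "n \<in> {1..N}"
      have "(\<Sum>m\<in>{1..<n}. s n m) \<le> (\<Sum>m\<in>{1..<n}. A * q ^ n)"
        by (intro sum_mono s_le) auto
      also have "\<dots> \<le> real n * (A * q ^ n)"
        using A q by (auto intro!: mult_right_mono)
      finally show "(\<Sum>m\<in>{1..<n}. s n m) \<le> A * (real n * q ^ n)" by (simp add: mult_ac)
    qed
    also have "\<dots> \<le> S"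
      unfolding S_def sum_distrib_left[symmetric] using A q sum
      by (intro mult_left_mono sum_le_suminf) auto
    finally show ?thesis .
  qed
  have "((\<lambda>N. S * ln (real N) powr (1 + 1) / (real N)\<^sup>2) \<longlongrightarrow> 0) sequentially"
    by real_asymp
  hence "\<forall>\<^sub>F N in sequentially. S * ln (real N) powr (1 + 1) / (real N)\<^sup>2 < 1"
    by (rule order_tendstoD(2)) simp
  hence "\<forall>\<^sub>F N in sequentially. 1 / (real N)\<^sup>2 * (\<Sum>n\<in>{1..N}. \<Sum>m\<in>{1..<n}. s n m)
      \<le> 1 / (ln (real N)) powr (1 + 1)"
    using eventually_gt_at_top[of 1]
  proof eventually_elim
    case (elim N)
    have ln: "0 < ln (real N) powr (1 + 1)" using elim by simp
    have "S / (real N)\<^sup>2 \<le> 1 / ln (real N) powr (1 + 1)"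
      using elim(1) unfolding pos_le_divide_eq[OF ln] by simp
    moreover have "1 / (real N)\<^sup>2 * (\<Sum>n\<in>{1..N}. \<Sum>m\<in>{1..<n}. s n m) \<le> S / (real N)\<^sup>2"
      using total[of N] by (simp add: divide_right_mono)
    ultimately show ?case by linarith
  qed
  thus "delta_scattered \<delta> (\<lambda>n. t * 2 ^ n)"
    unfolding delta_scattered_def s_def by (intro exI[of _ 1]) simp
qed

text \<open>Passing to fractional parts changes the sum over \<open>S\<close> by an integer. If all
  parts were in \<open>{0<..<d}\<close>, this integer would lie strictly between 0 and 1. The box
  with these sides is never hit, yet it has measure \<open>d ^ CARD('k)\<close>.\<close>

lemma not_uniformly_distributed_if_integer_sums:
  fixes x :: "nat \<Rightarrow> real ^ 'k" and S :: "'k set"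
  assumes "S \<noteq> {}" and int: "\<And>n. (\<Sum>i\<in>S. x n $ i) \<in> \<int>"
  shows "\<not> uniformly_distributed_mod1 x"
proof
  assume ud: "uniformly_distributed_mod1 x"
  \<comment> \<open>With this side length, \<open>card S\<close> fractional parts sum to at most
    1/2.\<close>
  define d where "d = 1 / (2 * real (card S))"
  have card: "card S > 0" using \<open>S \<noteq> {}\<close> by (simp add: card_gt_0_iff)
  have d: "0 < d" "d \<le> 1" using card by (auto simp: d_def)
  let ?I = "\<lambda>_ :: 'k. {0<..<d}"
  have none: "{n \<in> {1..N}. \<forall>i. frac (x n $ i) \<in> {0<..<d}} = {}" for N
  proof -
    have False if frac: "\<And>i. frac (x n $ i) \<in> {0<..<d}" for n
    proof -
      have "(\<Sum>i\<in>S. frac (x n $ i)) = (\<Sum>i\<in>S. x n $ i) - (\<Sum>i\<in>S. of_int \<lfloor>x n $ i\<rfloor>)"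
        by (simp add: frac_def sum_subtractf)
      also have "\<dots> \<in> \<int>" by (intro Ints_diff int) (intro Ints_sum Ints_of_int)
      finally have "(\<Sum>i\<in>S. frac (x n $ i)) \<in> \<int>" .
      moreover have "0 < (\<Sum>i\<in>S. frac (x n $ i))"
        using frac \<open>S \<noteq> {}\<close> by (intro sum_pos) auto
      moreover have "(\<Sum>i\<in>S. frac (x n $ i)) \<le> real (card S) * d"
        using frac by (intro sum_bounded_above) (auto simp: less_imp_le)
      ultimately have "0 < (\<Sum>i\<in>S. frac (x n $ i))" "(\<Sum>i\<in>S. frac (x n $ i)) < 1"
          "(\<Sum>i\<in>S. frac (x n $ i)) \<in> \<int>"
        using card by (auto simp: d_def split: if_splits)
      thus False by (auto elim!: Ints_cases)
    qed
    thus ?thesis by blast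
  qed
  have "\<forall>i. is_interval (?I i) \<and> ?I i \<subseteq> {0..1}" using d by (auto simp: is_interval_oo)
  hence "(\<lambda>N. real (card {n \<in> {1..N}. \<forall>i. frac (x n $ i) \<in> ?I i}) / real N)
          \<longlonglongrightarrow> measure lebesgue {y :: real ^ 'k. \<forall>i. y $ i \<in> ?I i}"
    by (rule ud[unfolded uniformly_distributed_mod1_def, THEN spec[of _ ?I], THEN mp])
  hence "(\<lambda>N. 0) \<longlonglongrightarrow> measure lebesgue {y :: real ^ 'k. \<forall>i. y $ i \<in> ?I i}"
    unfolding none by simp
  also have "measure lebesgue {y :: real ^ 'k. \<forall>i. y $ i \<in> ?I i} = d ^ CARD('k)"
    by (subst measure_lebesgue_box_of_intervals[of "\<lambda>_. 0" "\<lambda>_. d"])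
       (use d in \<open>auto simp: greaterThanLessThan_subseteq_atLeastAtMost_iff\<close>)
  finally have "d ^ CARD('k) = 0" using LIMSEQ_unique tendsto_const by blast
  thus False using d by simp
qed

theorem theorem3p1:
  fixes f :: "'k::finite \<Rightarrow> real \<Rightarrow> real"
  assumes "\<And>i. real_analytic (f i)"
  shows "lin_indep_with_one f \<longleftrightarrow>
    (\<forall>a :: 'k \<Rightarrow> nat \<Rightarrow> real. (\<forall>i. scattered (a i)) \<longrightarrow>
       (AE x in lebesgue. uniformly_distributed_mod1 (\<lambda>n. \<chi> i. a i n * f i x)))"
proof
  assume "lin_indep_with_one f"
  thus "\<forall>a :: 'k \<Rightarrow> nat \<Rightarrow> real. (\<forall>i. scattered (a i)) \<longrightarrow>
       (AE x in lebesgue. uniformly_distributed_mod1 (\<lambda>n. \<chi> i. a i n * f i x))"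
    using ae_uniformly_distributed[of f] assms by blast
next
  assume ae: "\<forall>a :: 'k \<Rightarrow> nat \<Rightarrow> real. (\<forall>i. scattered (a i)) \<longrightarrow>
       (AE x in lebesgue. uniformly_distributed_mod1 (\<lambda>n. \<chi> i. a i n * f i x))"
  show "lin_indep_with_one f"
  proof (rule ccontr)
    assume "\<not> lin_indep_with_one f"
    then obtain c\<^sub>0 c where dep: "\<And>x. c\<^sub>0 + (\<Sum>i\<in>UNIV. c i * f i x) = 0"
      and nontrivial: "c\<^sub>0 \<noteq> 0 \<or> (\<exists>i. c i \<noteq> 0)"
      unfolding lin_indep_with_one_def by auto
    \<comment> \<open>The support is nonempty, since otherwise the relation would force
      \<open>c\<^sub>0\<close> to vanish as well.\<close>
    define S where "S = {i. c i \<noteq> 0}"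
    have "S \<noteq> {}"
    proof
      assume "S = {}"
      hence "c i = 0" for i by (auto simp: S_def)
      thus False using dep[of 0] nontrivial by simp
    qed
    \<comment> \<open>With this scale the sum over \<open>S\<close> of \<open>a i n * f i x\<close> is \<open>0\<close> or \<open>- 2 ^ n\<close>.\<close>
    define t where "t = (if c\<^sub>0 = 0 then 1 else 1 / c\<^sub>0)"
    have t: "t \<noteq> 0" "c\<^sub>0 * t \<in> \<int>" by (auto simp: t_def)
    \<comment> \<open>Outside \<open>S\<close> the plain \<open>2 ^ n\<close> is used: the factor
      \<open>c i\<close> is 0 there, and a constant sequence is not scattered.\<close>
    define a where "a = (\<lambda>i n. (if i \<in> S then c i * t else 1) * 2 ^ n)"
    have "scattered (a i)" for i
      unfolding a_def by (rule scattered_geometric) (use t in \<open>auto simp: S_def\<close>)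
    hence "AE x in lebesgue. uniformly_distributed_mod1 (\<lambda>n. \<chi> i. a i n * f i x)"
      using ae by blast
    moreover have "\<not> uniformly_distributed_mod1 (\<lambda>n. \<chi> i. a i n * f i x)" for x
    proof (rule not_uniformly_distributed_if_integer_sums[OF \<open>S \<noteq> {}\<close>])
      fix n
      have "(\<Sum>i\<in>S. a i n * f i x) = (\<Sum>i\<in>S. t * 2 ^ n * (c i * f i x))"
        by (intro sum.cong) (auto simp: a_def)
      also have "\<dots> = t * 2 ^ n * (\<Sum>i\<in>S. c i * f i x)" by (simp add: sum_distrib_left)
      also have "(\<Sum>i\<in>S. c i * f i x) = (\<Sum>i\<in>UNIV. c i * f i x)"
        by (intro sum.mono_neutral_left) (auto simp: S_def)
      also have "\<dots> = - c\<^sub>0" using dep[of x] by simp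
      also have "t * 2 ^ n * (- c\<^sub>0) = - (c\<^sub>0 * t) * 2 ^ n" by simp
      also have "\<dots> \<in> \<int>" using t(2) by (intro Ints_mult[of "- (c\<^sub>0 * t)"] Ints_power) auto
      finally show "(\<Sum>i\<in>S. (\<chi> i. a i n * f i x) $ i) \<in> \<int>" by simp
    qed
    \<comment> \<open>Contradiction, since the whole line is not a null set.\<close>
    ultimately have "AE x in (lebesgue :: real measure). False" by simp
    thus False by (simp add: completion.AE_iff_null_sets flip: negligible_iff_null_sets)
  qed
qed

end
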